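(* Let $G$ be a (nilpotent of class 2)-by-abelian group of type Bredon-$\mathrm{FP}_2$ with respect to the family of all virtually cyclic subgroups of $G$, such that for every element $g\in G$ of infinite order the centralizer $C_G(g)$ is of type $\mathrm{FP}_2$. Then $G$ is virtually cyclic.
   Context: $G$ is (nilpotent of class 2)-by-abelian if it has a normal subgroup $N$ that is nilpotent of class 2 with $G/N$ abelian. A virtually cyclic group is one with a cyclic subgroup of finite index (finite groups are included). Let $\mathcal{VC}$ be the family of all virtually cyclic subgroups of $G$. The orbit category $\mathcal O_{\mathcal{VC}}G$ has as objects the transitive $G$-sets with stabilizers in $\mathcal{VC}$ and as morphisms the $G$-maps. An $\mathcal O_{\mathcal{VC}}G$-module is a contravariant functor from $\mathcal O_{\mathcal{VC}}G$ to abelian groups; exactness is defined pointwise. For a $G$-set $\Omega$ with stabilizers in $\mathcal{VC}$, $\mathbb Z[-,\Omega]$ is the $\mathcal O_{\mathcal{VC}}G$-module sending $\Delta$ to the free abelian group on the set of $G$-maps $\Delta\to\Omega$. A projective module is finitely generated if it is a direct summand of $\mathbb Z[-,\Omega]$ for some $\Omega$ with finitely many $G$-orbits and stabilizers in $\mathcal{VC}$. $G$ is of type Bredon-$\mathrm{FP}_n$ with respect to $\mathcal{VC}$ if the constant functor $\mathbb Z$ has a projective resolution $P_*$ over $\mathcal O_{\mathcal{VC}}G$ with $P_i$ finitely generated for all $i\le n$. Type $\mathrm{FP}_n$ for a group $H$ is the usual notion for the trivial $\mathbb ZH$-module $\mathbb Z$. *)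

theory Defs
  imports
    "HOL-Algebra.Group_Action"
    "HOL-Algebra.Module"
    "HOL-Algebra.Elementary_Groups"
    "HOL-Algebra.Multiplicative_Group"
    "HOL-Algebra.Free_Abelian_Groups"
begin

section \<open>Group-theoretic notions\<close>

definition virtually_cyclic :: "('a, 'b) monoid_scheme \<Rightarrow> bool"
  where "virtually_cyclic G \<longleftrightarrow>
    (\<exists>C. subgroup C G \<and> cyclic_group (G\<lparr>carrier := C\<rparr>) \<and> finite (rcosets\<^bsub>G\<^esub> C))"

definition VC :: "('a, 'b) monoid_scheme \<Rightarrow> 'a set set"
  where "VC G = {H. subgroup H G \<and> virtually_cyclic (G\<lparr>carrier := H\<rparr>)}"

definition centralizer :: "('a, 'b) monoid_scheme \<Rightarrow> 'a \<Rightarrow> 'a set"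
  where "centralizer G g = {x \<in> carrier G. x \<otimes>\<^bsub>G\<^esub> g = g \<otimes>\<^bsub>G\<^esub> x}"

primrec lower_central :: "('a, 'b) monoid_scheme \<Rightarrow> nat \<Rightarrow> 'a set"
  where
    "lower_central G 0 = carrier G"
  | "lower_central G (Suc n) = generate G
      {x \<otimes>\<^bsub>G\<^esub> y \<otimes>\<^bsub>G\<^esub> inv\<^bsub>G\<^esub> x \<otimes>\<^bsub>G\<^esub> inv\<^bsub>G\<^esub> y | x y. x \<in> lower_central G n \<and> y \<in> carrier G}"

text \<open>The index starts at 0, so stage \<open>c\<close> is the term usually written \<open>\<gamma>\<close> with index \<open>c + 1\<close>.
  As usual in compound notions of the form ``nilpotent of class \<open>c\<close>-by-abelian'', class \<open>c\<close> means
  class at most \<open>c\<close>.\<close>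

definition nilpotent_of_class :: "nat \<Rightarrow> ('a, 'b) monoid_scheme \<Rightarrow> bool"
  where "nilpotent_of_class c G \<longleftrightarrow> lower_central G c = {\<one>\<^bsub>G\<^esub>}"

definition nilpotent_by_abelian :: "nat \<Rightarrow> ('a, 'b) monoid_scheme \<Rightarrow> bool"
  where "nilpotent_by_abelian c G \<longleftrightarrow>
    (\<exists>N. N \<lhd> G \<and> nilpotent_of_class c (G\<lparr>carrier := N\<rparr>) \<and> comm_group (G Mod N))"


section \<open>Left modules over a ring and type FP\<close>

text \<open>The library locale \<^locale>\<open>module\<close> is restricted to commutative rings.\<close>

locale left_module = R?: ring R + M?: abelian_group M
  for R :: "('r, 'c) ring_scheme" (structure) and M :: "('r, 'm) module" (structure) +
  assumes smult_closed:
      "\<lbrakk>a \<in> carrier R; x \<in> carrier M\<rbrakk> \<Longrightarrow> a \<odot>\<^bsub>M\<^esub> x \<in> carrier M"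
    and smult_l_distr:
      "\<lbrakk>a \<in> carrier R; b \<in> carrier R; x \<in> carrier M\<rbrakk> \<Longrightarrow>
       (a \<oplus> b) \<odot>\<^bsub>M\<^esub> x = a \<odot>\<^bsub>M\<^esub> x \<oplus>\<^bsub>M\<^esub> b \<odot>\<^bsub>M\<^esub> x"
    and smult_r_distr:
      "\<lbrakk>a \<in> carrier R; x \<in> carrier M; y \<in> carrier M\<rbrakk> \<Longrightarrow>
       a \<odot>\<^bsub>M\<^esub> (x \<oplus>\<^bsub>M\<^esub> y) = a \<odot>\<^bsub>M\<^esub> x \<oplus>\<^bsub>M\<^esub> a \<odot>\<^bsub>M\<^esub> y"
    and smult_assoc:
      "\<lbrakk>a \<in> carrier R; b \<in> carrier R; x \<in> carrier M\<rbrakk> \<Longrightarrow>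
       (a \<otimes> b) \<odot>\<^bsub>M\<^esub> x = a \<odot>\<^bsub>M\<^esub> (b \<odot>\<^bsub>M\<^esub> x)"
    and smult_one:
      "x \<in> carrier M \<Longrightarrow> \<one> \<odot>\<^bsub>M\<^esub> x = x"

definition lmod_hom ::
    "('r, 'c) ring_scheme \<Rightarrow> ('r, 'm) module \<Rightarrow> ('r, 'n) module \<Rightarrow> ('m \<Rightarrow> 'n) set"
  where "lmod_hom R M N = {f \<in> hom (add_monoid M) (add_monoid N).
    \<forall>r\<in>carrier R. \<forall>x\<in>carrier M. f (r \<odot>\<^bsub>M\<^esub> x) = r \<odot>\<^bsub>N\<^esub> f x}"

definition lmod_finitely_generated :: "('r, 'c) ring_scheme \<Rightarrow> ('r, 'm) module \<Rightarrow> bool"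
  where "lmod_finitely_generated R M \<longleftrightarrow>
    (\<exists>S \<subseteq> carrier M. finite S \<and> (\<forall>N. submodule N R M \<and> S \<subseteq> N \<longrightarrow> N = carrier M))"

text \<open>The lifting property is tested against all modules whose underlying set lies in the same type
  \<open>'m\<close> as \<open>P\<close>. If \<open>'m\<close> is infinite and at least as large as \<open>R\<close>, this is projectivity in the
  category of all modules: the free module on the set \<open>P\<close> then has a copy in \<open>'m\<close>, and
  lifting the identity of \<open>P\<close> along the canonical epimorphism makes \<open>P\<close> a direct summand of it.\<close>

definition lmod_projective :: "('r, 'c) ring_scheme \<Rightarrow> ('r, 'm) module \<Rightarrow> bool"
  where "lmod_projective R P \<longleftrightarrow> left_module R P \<and>
    (\<forall>(A :: ('r, 'm) module) (B :: ('r, 'm) module) p f.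
      left_module R A \<and> left_module R B \<and>
      p \<in> lmod_hom R A B \<and> p ` carrier A = carrier B \<and> f \<in> lmod_hom R P B \<longrightarrow>
      (\<exists>g \<in> lmod_hom R P A. \<forall>x\<in>carrier P. p (g x) = f x))"

definition lmod_projective_resolution ::
    "('r, 'c) ring_scheme \<Rightarrow> (nat \<Rightarrow> ('r, 'm) module) \<Rightarrow> (nat \<Rightarrow> 'm \<Rightarrow> 'm) \<Rightarrow> ('m \<Rightarrow> 'n) \<Rightarrow>
     ('r, 'n) module \<Rightarrow> bool"
  where "lmod_projective_resolution R P d \<epsilon> M \<longleftrightarrow>
    (\<forall>i. lmod_projective R (P i)) \<and>
    (\<forall>i. d i \<in> lmod_hom R (P (Suc i)) (P i)) \<and>
    \<epsilon> \<in> lmod_hom R (P 0) M \<and>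
    \<epsilon> ` carrier (P 0) = carrier M \<and>
    d 0 ` carrier (P (Suc 0)) = kernel (add_monoid (P 0)) (add_monoid M) \<epsilon> \<and>
    (\<forall>i. d (Suc i) ` carrier (P (Suc (Suc i))) =
       kernel (add_monoid (P (Suc i))) (add_monoid (P i)) (d i))"

definition group_ring :: "('a, 'b) monoid_scheme \<Rightarrow> ('a \<Rightarrow>\<^sub>0 int) ring"
  where "group_ring H = \<lparr>carrier = {c. Poly_Mapping.keys c \<subseteq> carrier H},
    monoid.mult = (\<lambda>x y. frag_extend (\<lambda>g. frag_extend (\<lambda>h. frag_of (g \<otimes>\<^bsub>H\<^esub> h)) y) x),
    one = frag_of \<one>\<^bsub>H\<^esub>, ring.zero = 0, ring.add = (+)\<rparr>"

text \<open>A group ring element acts on the trivial module through its augmentation; the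
  multiplicative fields of the record play no role.\<close>

definition trivial_module :: "('a \<Rightarrow>\<^sub>0 int, int) module"
  where "trivial_module = \<lparr>carrier = UNIV, monoid.mult = (*), one = 1, ring.zero = 0, ring.add = (+),
    smult = (\<lambda>c n. (\<Sum>g\<in>Poly_Mapping.keys c. Poly_Mapping.lookup c g) * n)\<rparr>"

text \<open>The modules of the resolution have underlying sets in \<open>(nat \<times> 'a) \<Rightarrow>\<^sub>0 int\<close>, which holds the
  countably generated free modules over the group ring and is infinite and at least as large as
  the group ring. Hence the choice of type is no restriction: a resolution by arbitrary modules
  with finitely generated terms up to degree \<open>n\<close> can be replaced by one in this type, by
  continuing beyond degree \<open>n\<close> with free covers of the kernels.\<close>

definition group_FP :: "nat \<Rightarrow> ('a, 'b) monoid_scheme \<Rightarrow> bool"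
  where "group_FP n H \<longleftrightarrow>
    (\<exists>(P :: nat \<Rightarrow> ('a \<Rightarrow>\<^sub>0 int, (nat \<times> 'a) \<Rightarrow>\<^sub>0 int) module) d \<epsilon>.
      lmod_projective_resolution (group_ring H) P d \<epsilon> trivial_module \<and>
      (\<forall>i\<le>n. lmod_finitely_generated (group_ring H) (P i)))"


section \<open>Modules over the orbit category and Bredon type FP\<close>

record ('a, 'x) gset =
  points :: "'x set"
  action :: "'a \<Rightarrow> 'x \<Rightarrow> 'x"

definition gset_with_stabilizers ::
    "('a, 'b) monoid_scheme \<Rightarrow> 'a set set \<Rightarrow> ('a, 'x) gset \<Rightarrow> bool"
  where "gset_with_stabilizers G F X \<longleftrightarrow> group_action G (points X) (action X) \<and>
    (\<forall>x\<in>points X. stabilizer G (action X) x \<in> F)"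

text \<open>The library predicate \<^locale>\<open>transitive_action\<close> allows the empty set.\<close>

definition orbit_objects ::
    "('a, 'b) monoid_scheme \<Rightarrow> 'a set set \<Rightarrow> ('a, 'x) gset set"
  where "orbit_objects G F = {X. gset_with_stabilizers G F X \<and>
    transitive_action G (points X) (action X) \<and> points X \<noteq> {}}"

definition gset_maps ::
    "('a, 'b) monoid_scheme \<Rightarrow> ('a, 'x) gset \<Rightarrow> ('a, 'y) gset \<Rightarrow> ('x \<Rightarrow> 'y) set"
  where "gset_maps G X Y = {f \<in> points X \<rightarrow>\<^sub>E points Y.
    \<forall>g\<in>carrier G. \<forall>x\<in>points X. f (action X g x) = action Y g (f x)}"

text \<open>A contravariant functor from the orbit category to abelian groups (written multiplicatively):
  \<open>tr M X Y f\<close> is the map \<open>ev M Y \<rightarrow> ev M X\<close> induced by \<open>f : X \<rightarrow> Y\<close>.\<close>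

record ('a, 'x, 'm) orbit_module =
  ev :: "('a, 'x) gset \<Rightarrow> 'm monoid"
  tr :: "('a, 'x) gset \<Rightarrow> ('a, 'x) gset \<Rightarrow> ('x \<Rightarrow> 'x) \<Rightarrow> 'm \<Rightarrow> 'm"

definition is_orbit_module ::
    "('a, 'b) monoid_scheme \<Rightarrow> 'a set set \<Rightarrow> ('a, 'x, 'm) orbit_module \<Rightarrow> bool"
  where "is_orbit_module G F M \<longleftrightarrow>
    (\<forall>X\<in>orbit_objects G F. comm_group (ev M X)) \<and>
    (\<forall>X\<in>orbit_objects G F. \<forall>Y\<in>orbit_objects G F. \<forall>f\<in>gset_maps G X Y.
       tr M X Y f \<in> hom (ev M Y) (ev M X)) \<and>
    (\<forall>X\<in>orbit_objects G F. \<forall>m\<in>carrier (ev M X). tr M X X (\<lambda>x\<in>points X. x) m = m) \<and>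
    (\<forall>X\<in>orbit_objects G F. \<forall>Y\<in>orbit_objects G F. \<forall>Z\<in>orbit_objects G F.
       \<forall>f\<in>gset_maps G X Y. \<forall>h\<in>gset_maps G Y Z. \<forall>m\<in>carrier (ev M Z).
       tr M X Z (compose (points X) h f) m = tr M X Y f (tr M Y Z h m))"

definition orbit_module_hom ::
    "('a, 'b) monoid_scheme \<Rightarrow> 'a set set \<Rightarrow> ('a, 'x, 'm) orbit_module \<Rightarrow>
     ('a, 'x, 'n) orbit_module \<Rightarrow> (('a, 'x) gset \<Rightarrow> 'm \<Rightarrow> 'n) set"
  where "orbit_module_hom G F M N = {\<eta>.
    (\<forall>X\<in>orbit_objects G F. \<eta> X \<in> hom (ev M X) (ev N X)) \<and>
    (\<forall>X\<in>orbit_objects G F. \<forall>Y\<in>orbit_objects G F. \<forall>f\<in>gset_maps G X Y.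
       \<forall>m\<in>carrier (ev M Y). \<eta> X (tr M X Y f m) = tr N X Y f (\<eta> Y m))}"

definition orbit_module_iso ::
    "('a, 'b) monoid_scheme \<Rightarrow> 'a set set \<Rightarrow> ('a, 'x, 'm) orbit_module \<Rightarrow>
     ('a, 'x, 'n) orbit_module \<Rightarrow> bool"
  where "orbit_module_iso G F M N \<longleftrightarrow> (\<exists>\<eta> \<in> orbit_module_hom G F M N.
    \<forall>X\<in>orbit_objects G F. \<eta> X \<in> iso (ev M X) (ev N X))"

definition orbit_module_sum ::
    "('a, 'x, 'm) orbit_module \<Rightarrow> ('a, 'x, 'n) orbit_module \<Rightarrow> ('a, 'x, 'm \<times> 'n) orbit_module"
  where "orbit_module_sum M N = \<lparr>ev = (\<lambda>X. ev M X \<times>\<times> ev N X),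
    tr = (\<lambda>X Y f. map_prod (tr M X Y f) (tr N X Y f))\<rparr>"

definition const_int_module :: "('a, 'x, int) orbit_module"
  where "const_int_module = \<lparr>ev = (\<lambda>X. integer_group), tr = (\<lambda>X Y f n. n)\<rparr>"

text \<open>The module sending \<open>X\<close> to the free abelian group on the set of \<open>G\<close>-maps from \<open>X\<close> to \<open>\<Omega>\<close>.\<close>

definition free_orbit_module ::
    "('a, 'b) monoid_scheme \<Rightarrow> ('a, 'w) gset \<Rightarrow> ('a, 'x, ('x \<Rightarrow> 'w) \<Rightarrow>\<^sub>0 int) orbit_module"
  where "free_orbit_module G \<Omega> = \<lparr>ev = (\<lambda>X. free_Abelian_group (gset_maps G X \<Omega>)),
    tr = (\<lambda>X Y f. frag_extend (\<lambda>h. frag_of (compose (points X) h f)))\<rparr>"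

text \<open>As for modules over a ring, the lifting property is tested on modules with values in the type
  \<open>'m\<close>. This is projectivity in the whole functor category when \<open>'m\<close> is infinite and at least
  as large as \<open>G\<close> and its set of subgroups, since \<open>P\<close> is then a quotient of a free module that
  has a copy with values in \<open>'m\<close>. Epimorphisms are the pointwise surjective homomorphisms.\<close>

definition orbit_module_projective ::
    "('a, 'b) monoid_scheme \<Rightarrow> 'a set set \<Rightarrow> ('a, 'x, 'm) orbit_module \<Rightarrow> bool"
  where "orbit_module_projective G F P \<longleftrightarrow> is_orbit_module G F P \<and>
    (\<forall>(A :: ('a, 'x, 'm) orbit_module) (B :: ('a, 'x, 'm) orbit_module) p f.
      is_orbit_module G F A \<and> is_orbit_module G F B \<and>
      p \<in> orbit_module_hom G F A B \<and>
      (\<forall>X\<in>orbit_objects G F. p X ` carrier (ev A X) = carrier (ev B X)) \<and>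
      f \<in> orbit_module_hom G F P B \<longrightarrow>
      (\<exists>g \<in> orbit_module_hom G F P A.
        \<forall>X\<in>orbit_objects G F. \<forall>x\<in>carrier (ev P X). p X (g X x) = f X x))"

text \<open>Transitive \<open>G\<close>-sets are taken with points in \<open>'a set\<close>, the type of the cosets of subgroups of
  \<open>G\<close>, so that up to isomorphism all of them occur. Likewise every \<open>G\<close>-set with finitely many
  orbits is isomorphic to one with points in \<open>nat \<times> 'a set\<close>. A complement of a summand of the free
  module on \<open>\<Omega>\<close> is isomorphic to a submodule of that module, so the type of \<open>Q\<close>
  is no restriction either.\<close>

definition orbit_module_fg_projective ::
    "('a, 'b) monoid_scheme \<Rightarrow> 'a set set \<Rightarrow> ('a, 'a set, 'm) orbit_module \<Rightarrow> bool"
  where "orbit_module_fg_projective G F P \<longleftrightarrow> orbit_module_projective G F P \<and>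
    (\<exists>(\<Omega> :: ('a, nat \<times> 'a set) gset)
       (Q :: ('a, 'a set, ('a set \<Rightarrow> nat \<times> 'a set) \<Rightarrow>\<^sub>0 int) orbit_module).
      gset_with_stabilizers G F \<Omega> \<and> finite (orbits G (points \<Omega>) (action \<Omega>)) \<and>
      is_orbit_module G F Q \<and>
      orbit_module_iso G F (orbit_module_sum P Q) (free_orbit_module G \<Omega>))"

definition orbit_module_projective_resolution ::
    "('a, 'b) monoid_scheme \<Rightarrow> 'a set set \<Rightarrow> (nat \<Rightarrow> ('a, 'x, 'm) orbit_module) \<Rightarrow>
     (nat \<Rightarrow> ('a, 'x) gset \<Rightarrow> 'm \<Rightarrow> 'm) \<Rightarrow> (('a, 'x) gset \<Rightarrow> 'm \<Rightarrow> 'n) \<Rightarrow>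
     ('a, 'x, 'n) orbit_module \<Rightarrow> bool"
  where "orbit_module_projective_resolution G F P d \<epsilon> M \<longleftrightarrow>
    (\<forall>i. orbit_module_projective G F (P i)) \<and>
    (\<forall>i. d i \<in> orbit_module_hom G F (P (Suc i)) (P i)) \<and>
    \<epsilon> \<in> orbit_module_hom G F (P 0) M \<and>
    (\<forall>X\<in>orbit_objects G F.
      \<epsilon> X ` carrier (ev (P 0) X) = carrier (ev M X) \<and>
      d 0 X ` carrier (ev (P (Suc 0)) X) = kernel (ev (P 0) X) (ev M X) (\<epsilon> X) \<and>
      (\<forall>i. d (Suc i) X ` carrier (ev (P (Suc (Suc i))) X) =
         kernel (ev (P (Suc i)) X) (ev (P i) X) (d i X)))"

text \<open>This value type holds all free modules on \<open>G\<close>-sets with points in \<open>nat \<times> 'a set\<close> and is large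
  enough for the remark on projectivity above; as for modules over a ring, fixing it
  does not restrict the existence of resolutions.\<close>

definition bredon_FP :: "nat \<Rightarrow> ('a, 'b) monoid_scheme \<Rightarrow> 'a set set \<Rightarrow> bool"
  where "bredon_FP n G F \<longleftrightarrow>
    (\<exists>(P :: nat \<Rightarrow> ('a, 'a set, ('a set \<Rightarrow> nat \<times> 'a set) \<Rightarrow>\<^sub>0 int) orbit_module) d \<epsilon>.
      orbit_module_projective_resolution G F P d \<epsilon> const_int_module \<and>
      (\<forall>i\<le>n. orbit_module_fg_projective G F (P i)))"

end

theory Submission
  imports Defs
begin

text \<open>Evaluate a Bredon resolution at the orbit \<open>G/\<langle>g\<rangle>\<close>. The augmentation is onto there, so some
  \<open>G\<close>-map \<open>G/\<langle>g\<rangle> \<rightarrow> \<Omega>\<close> exists, where \<open>\<Omega>\<close> is a fixed \<open>G\<close>-set with finitely many orbits and virtually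
  cyclic stabilizers. Hence \<open>g\<close> fixes a point of \<open>\<Omega>\<close>, and \<open>G\<close> is the union of the conjugates of
  finitely many virtually cyclic subgroups \<open>K\<close> (\<open>bredon_FP_finite_VC_cover\<close>). For a group with a
  normal subgroup \<open>N\<close> of class 2 and an abelian quotient \<open>G/N\<close>, this covering property forces
  \<open>G\<close> to be virtually cyclic (\<open>virtually_cyclic_if_finite_VC_cover\<close>).

  In an abelian quotient conjugation disappears: the quotient is a finite union of images of the
  \<open>K\<close>, so by B. H. Neumann's lemma on coverings by cosets one cyclic subgroup has finite index
  (\<open>abelian_image_cyclic_cover\<close>). So some \<open>t\<close> generates \<open>G/N\<close> up to finite index. If \<open>G/N\<close> is
  finite, then \<open>N\<close> inherits a covering of the same kind, and \<open>N/N'\<close> is virtually cyclic too.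

  If \<open>t\<close> has infinite order modulo \<open>N\<close>, conjugation by \<open>t\<close> makes \<open>A = N/N'\<close> a module over
  \<open>\<int>[t, 1/t]\<close>, and \<open>A\<close> must be finite (\<open>finite_abelian_section\<close>). For each \<open>K\<close>, the number of
  elements of \<open>K\<close> in the coset \<open>N t\<^sup>n\<close> is bounded independently of \<open>n > 0\<close>, so \<open>t\<close> has a bounded
  number \<open>C\<close> of orbits on \<open>A/(t\<^sup>n - 1)A\<close>. On the other hand the elements of \<open>N\<close> are covered by the
  conjugates of the \<open>K \<inter> N\<close>, and two elements of one \<open>K\<close> have dependent powers. Comparing the
  elements \<open>x + t\<^sup>k x\<close> for different \<open>k\<close> gives a nontrivial polynomial relation for each
  \<open>x \<in> A\<close>; so \<open>A\<close> has finite rank and only finitely many primes become invertible in it. If \<open>A\<close> is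
  torsion, the outer coefficients of these relations can be taken to be units, and \<open>A\<close> is
  finite. Otherwise there is a \<open>q > 1\<close> with \<open>A/q\<^sup>C A\<close> finite and containing
  elements of each of the orders \<open>1, q, \<dots>, q\<^sup>C\<close>. Some power \<open>t\<^sup>n\<close> acts trivially on this quotient,
  and elements of different orders lie in different orbits: these are \<open>C + 1\<close> orbits, one too
  many (\<open>finite_if_few_twisted_classes\<close>).

  In both cases \<open>N/N'\<close> is virtually cyclic. Since \<open>N\<close> has class 2, its commutators are bilinear and
  depend only on classes modulo \<open>N'\<close>, and powers of any two elements of \<open>N\<close> agree modulo \<open>N'\<close> with
  powers of one element, so every commutator has finite order and \<open>N'\<close> is finite
  (\<open>finite_derived_of_central\<close>). Reassembling \<open>N'\<close>, \<open>N/N'\<close> and \<open>G/N\<close>, of which at most one of the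
  last two is infinite, gives the result.\<close>

section \<open>Finitely generated abelian groups\<close>

lemma (in comm_group) generate_insert:
  assumes "x \<in> carrier G" "X \<subseteq> carrier G"
  shows "generate G (insert x X) = {x [^] (i::int) \<otimes> y | i y. y \<in> generate G X}"
proof
  show "{x [^] (i::int) \<otimes> y | i y. y \<in> generate G X} \<subseteq> generate G (insert x X)"
  proof clarify
    fix i :: int and y
    assume "y \<in> generate G X"
    then have "y \<in> generate G (insert x X)"
      using mono_generate[of X "insert x X"] by blast
    moreover have "x [^] i \<in> generate G (insert x X)"
      using assms by (intro subgroup_int_pow_closed[OF generate_is_subgroup]) (auto intro: generate.incl)
    ultimately show "x [^] i \<otimes> y \<in> generate G (insert x X)"
      by (intro generate.eng)
  qed
  show "generate G (insert x X) \<subseteq> {x [^] (i::int) \<otimes> y | i y. y \<in> generate G X}"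
  proof
    fix z assume "z \<in> generate G (insert x X)"
    then show "z \<in> {x [^] (i::int) \<otimes> y | i y. y \<in> generate G X}"
    proof (induction rule: generate.induct)
      case one
      have "\<one> = x [^] (0::int) \<otimes> \<one>" by simp
      then show ?case using generate.one[of G X] by blast
    next
      case (incl h)
      then consider "h = x" | "h \<in> X" by blast
      then show ?case
      proof cases
        case 1
        then have "h = x [^] (1::int) \<otimes> \<one>" using assms by simp
        then show ?thesis using generate.one[of G X] by blast
      next
        case 2
        then have "h = x [^] (0::int) \<otimes> h" using assms by auto
        then show ?thesis using generate.incl[OF 2] by blast
      qed
    next
      case (inv h)
      then consider "h = x" | "h \<in> X" by blast
      then show ?case
      proof cases
        case 1
        then have "inv h = x [^] (-1::int) \<otimes> \<one>" using assms by (simp add: int_pow_neg)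
        then show ?thesis using generate.one[of G X] by blast
      next
        case 2
        then have "inv h = x [^] (0::int) \<otimes> inv h" using assms by auto
        then show ?thesis using generate.inv[OF 2] by blast
      qed
    next
      case (eng h1 h2)
      then obtain i j :: int and y z where
        h: "h1 = x [^] i \<otimes> y" "h2 = x [^] j \<otimes> z" and yz: "y \<in> generate G X" "z \<in> generate G X"
        by blast
      have "y \<in> carrier G" "z \<in> carrier G"
        using yz generate_incl[OF assms(2)] by auto
      then have "h1 \<otimes> h2 = x [^] (i + j) \<otimes> (y \<otimes> z)"
        using assms(1) unfolding h by (simp add: int_pow_mult[symmetric] m_ac)
      then show ?case using generate.eng[OF yz] by blast
    qed
  qed
qed

lemma (in comm_group) finite_generate_torsion:
  assumes "finite X" "X \<subseteq> carrier G" "\<And>x. x \<in> X \<Longrightarrow> \<exists>e::int. e > 0 \<and> x [^] e = \<one>"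
  shows "finite (generate G X)"
  using assms
proof (induction X)
  case empty
  then show ?case by (simp add: generate_empty)
next
  case (insert x X)
  obtain e :: int where e: "e > 0" "x [^] e = \<one>"
    using insert.prems(2)[of x] by auto
  have x: "x \<in> carrier G" using insert.prems by simp
  have "x [^] i = x [^] (i mod e)" for i
  proof -
    have "x [^] i = x [^] (e * (i div e) + i mod e)" by simp
    also have "\<dots> = (x [^] e) [^] (i div e) \<otimes> x [^] (i mod e)"
      using x by (simp only: int_pow_mult int_pow_pow)
    finally show ?thesis using e x by simp
  qed
  note mod = this
  have "generate G (insert x X) \<subseteq> (\<lambda>(i, y). x [^] (i::int) \<otimes> y) ` ({0..<e} \<times> generate G X)"
  proof
    fix z assume "z \<in> generate G (insert x X)"
    then obtain i :: int and y where z: "z = x [^] i \<otimes> y" "y \<in> generate G X"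
      using generate_insert[OF x, of X] insert.prems by auto
    have "z = x [^] (i mod e) \<otimes> y" using z(1) mod[of i] by simp
    moreover have "i mod e \<in> {0..<e}" using e by simp
    ultimately show "z \<in> (\<lambda>(i, y). x [^] (i::int) \<otimes> y) ` ({0..<e} \<times> generate G X)"
      using z(2) by (intro image_eqI[of _ _ "(i mod e, y)"]) auto
  qed
  moreover have "finite (generate G X)"
    using insert by auto
  ultimately show ?case
    by (meson finite_SigmaI finite_atLeastLessThan_int finite_imageI finite_subset)
qed

lemma (in group) subgroup_int_pow_dvd:
  assumes "subgroup H G" "a \<in> carrier G" "a [^] (p::int) \<in> H" "p dvd q"
  shows "a [^] q \<in> H"
proof -
  obtain r where "q = p * r" using assms(4) by (auto simp: dvd_def)
  then have "a [^] q = (a [^] p) [^] r" using assms(2) by (simp add: int_pow_pow)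
  then show ?thesis using subgroup_int_pow_closed[OF assms(1,3)] by simp
qed

section \<open>Abelian groups with an action of the integers\<close>

locale integer_action = comm_group +
  fixes T :: "int \<Rightarrow> 'a \<Rightarrow> 'a"
  assumes T_hom: "T j \<in> hom G G"
    and T_0: "x \<in> carrier G \<Longrightarrow> T 0 x = x"
    and T_T: "x \<in> carrier G \<Longrightarrow> T i (T j x) = T (i + j) x"
begin

lemma T_closed [simp, intro]: "x \<in> carrier G \<Longrightarrow> T j x \<in> carrier G"
  using T_hom hom_in_carrier by metis

lemma T_mult: "x \<in> carrier G \<Longrightarrow> y \<in> carrier G \<Longrightarrow> T j (x \<otimes> y) = T j x \<otimes> T j y"
  using T_hom hom_mult by metis

lemma T_pow: "x \<in> carrier G \<Longrightarrow> T j (x [^] (i::int)) = T j x [^] i"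
  using T_hom[of j] is_group by (simp add: hom_int_pow)

lemma T_one: "T j \<one> = \<one>"
  using T_pow[of "\<one>" j 0] by simp

lemma T_inv: "x \<in> carrier G \<Longrightarrow> T j (inv x) = inv (T j x)"
  using T_pow[of x j "-1"] by (simp add: int_pow_neg)

lemma T_generate:
  assumes "X \<subseteq> carrier G" "u \<in> generate G X"
  shows "T j u \<in> generate G (T j ` X)"
proof -
  interpret h: group_hom G G "T j"
    using T_hom by (simp add: group_hom_def group_hom_axioms_def is_group)
  show ?thesis using h.generate_img[OF assms(1)] assms(2) by auto
qed

text \<open>A Laurent polynomial \<open>\<Sum>c\<^sub>i t\<^sup>i\<close> that kills \<open>x\<close> is used only through its lowest and highest
  terms: each of them can be moved to the other side and so lies in the span of the remaining
  translates of \<open>x\<close>.\<close>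

lemma extreme_terms_of_relation:
  fixes c :: "int \<Rightarrow> int"
  assumes x: "x \<in> carrier G"
    and rel: "(\<Otimes>i\<in>{L..U}. T i x [^] c i) = \<one>"
    and nz: "i0 \<in> {L..U}" "c i0 \<noteq> 0"
  obtains lo hi where "lo \<le> hi" "c lo \<noteq> 0" "c hi \<noteq> 0"
    "T lo x [^] c lo \<in> generate G ((\<lambda>i. T i x) ` {lo<..hi})"
    "T hi x [^] c hi \<in> generate G ((\<lambda>i. T i x) ` {lo..<hi})"
proof -
  define S where "S = {i \<in> {L..U}. c i \<noteq> 0}"
  define lo where "lo = Min S"
  define hi where "hi = Max S"
  have "S \<subseteq> {L..U}" by (auto simp: S_def)
  then have S: "finite S" "S \<noteq> {}" using nz finite_subset by (auto simp: S_def)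
  have lo: "lo \<in> S" "\<And>i. i \<in> S \<Longrightarrow> lo \<le> i" and hi: "hi \<in> S" "\<And>i. i \<in> S \<Longrightarrow> i \<le> hi"
    using S by (auto simp: lo_def hi_def)
  have "(\<Otimes>i\<in>S. T i x [^] c i) = (\<Otimes>i\<in>{L..U}. T i x [^] c i)"
    using x by (intro finprod_mono_neutral_cong_left) (auto simp: S_def)
  then have rel': "(\<Otimes>i\<in>S. T i x [^] c i) = \<one>" using rel by simp
  have gen: "T s x [^] c s \<in> generate G ((\<lambda>i. T i x) ` I)" if s: "s \<in> S" and I: "S - {s} \<subseteq> I" for s I
  proof -
    let ?B = "generate G ((\<lambda>i. T i x) ` I)"
    let ?p = "\<Otimes>i\<in>S - {s}. T i x [^] c i"
    have sub: "subgroup ?B G" using x by (intro generate_is_subgroup) auto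
    have "(\<Otimes>i\<in>insert s (S - {s}). T i x [^] c i) = T s x [^] c s \<otimes> ?p"
      using x S by (subst finprod_insert) auto
    then have "T s x [^] c s \<otimes> ?p = \<one>"
      using rel' s by (simp add: insert_absorb)
    then have eq: "T s x [^] c s = inv ?p"
      using x by (intro inv_equality[symmetric]) auto
    have "finprod G (\<lambda>i. T i x [^] c i) J \<in> ?B" if "finite J" "J \<subseteq> I" for J
      using that
    proof (induction J)
      case empty
      then show ?case by (simp add: generate.one)
    next
      case (insert i J)
      then have "T i x [^] c i \<in> ?B"
        by (intro subgroup_int_pow_closed[OF sub] generate.incl) auto
      then show ?case using insert x by (simp add: generate.eng)
    qed
    then have "?p \<in> ?B" using S I by blast
    then show ?thesis unfolding eq using sub by (simp add: subgroup.m_inv_closed)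
  qed
  show thesis
  proof (rule that[of lo hi])
    show "lo \<le> hi" using lo hi by blast
    show "c lo \<noteq> 0" "c hi \<noteq> 0" using lo hi by (auto simp: S_def)
    show "T lo x [^] c lo \<in> generate G ((\<lambda>i. T i x) ` {lo<..hi})"
      using lo(1) hi(2) lo(2) by (intro gen) (auto simp: less_le)
    show "T hi x [^] c hi \<in> generate G ((\<lambda>i. T i x) ` {lo..<hi})"
      using hi(1) hi(2) lo(2) by (intro gen) (auto simp: less_le)
  qed
qed

lemma finprod_single:
  assumes "x \<in> carrier G" "k \<in> {L..U}"
  shows "(\<Otimes>i\<in>{L..U::int}. T i x [^] (if i = k then m else 0::int)) = T k x [^] m"
proof -
  have "(\<Otimes>i\<in>{L..U}. T i x [^] (if i = k then m else 0)) =
      (\<Otimes>i\<in>{L..U}. if i = k then T i x [^] m else \<one>)"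
    using assms by (intro finprod_cong) (auto simp: simp_implies_def)
  also have "\<dots> = T k x [^] m"
    using assms finprod_singleton_swap[of k "{L..U}" "\<lambda>i. T i x [^] m"] 
     by auto
  finally show ?thesis .
qed

text \<open>The elements \<open>x + t\<^sup>k x\<close> are chosen because in a free module over \<open>\<int>[t, 1/t]\<close> no two of them
  are dependent, even after a shift by \<open>t\<^sup>j\<close>: \<open>m (1 + t\<^sup>k) - n t\<^sup>j (1 + t\<^sup>l)\<close> is a nonzero Laurent polynomial when
  \<open>k \<noteq> l\<close>, with coefficients of absolute value at most 1 when \<open>m = n = 1\<close>. The latter case is
  what makes the orbit of a torsion element finite.\<close>

lemma relation_of_dependent_sums:
  fixes m n k l :: int
  assumes x: "x \<in> carrier G" and kl: "0 < k" "0 < l" "k \<noteq> l"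
    and mn: "m \<noteq> 0 \<or> n \<noteq> 0"
    and eq: "(x \<otimes> T k x) [^] m = T j (x \<otimes> T l x) [^] n"
  obtains lo hi p q :: int where "lo \<le> hi" "p \<noteq> 0" "q \<noteq> 0"
    "m = 1 \<Longrightarrow> n = 1 \<Longrightarrow> \<bar>p\<bar> = 1 \<and> \<bar>q\<bar> = 1"
    "T lo x [^] p \<in> generate G ((\<lambda>i. T i x) ` {lo<..hi})"
    "T hi x [^] q \<in> generate G ((\<lambda>i. T i x) ` {lo..<hi})"
proof -
  define e :: "int \<Rightarrow> int \<Rightarrow> int \<Rightarrow> int" where "e s a = (\<lambda>i. if i = s then a else 0)" for s a
  define c where "c i = (e 0 m i + e k m i) + (e j (-n) i + e (j+l) (-n) i)" for i
  \<comment> \<open>The interval from \<open>L\<close> to \<open>U\<close> contains the four exponents that occur in the relation.\<close>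
  define L where "L = min 0 j"
  define U where "U = max k (j + l)"
  have mem: "0 \<in> {L..U}" "k \<in> {L..U}" "j \<in> {L..U}" "j + l \<in> {L..U}"
    using kl by (auto simp: L_def U_def)
  have E: "(\<Otimes>i\<in>{L..U}. T i x [^] e s a i) = T s x [^] a" if "s \<in> {L..U}" for s a
    using finprod_single[OF x that] by (simp add: e_def)
  have "(\<Otimes>i\<in>{L..U}. T i x [^] c i) =
      (T 0 x [^] m \<otimes> T k x [^] m) \<otimes> (T j x [^] (-n) \<otimes> T (j+l) x [^] (-n))"
    unfolding c_def using x mem by (simp add: int_pow_mult finprod_multf Pi_def E)
  also have "\<dots> = (x \<otimes> T k x) [^] m \<otimes> inv (T j (x \<otimes> T l x) [^] n)"
    using x by (simp add: T_0 T_T T_mult int_pow_neg int_pow_distrib inv_mult)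
  also have "\<dots> = \<one>"
    using x unfolding eq by simp
  finally have rel: "(\<Otimes>i\<in>{L..U}. T i x [^] c i) = \<one>" .
  have "\<exists>i0\<in>{0,k,j,j+l}. c i0 \<noteq> 0"
    using kl mn unfolding c_def e_def
    by (simp; smt (verit))
  then obtain i0 where i0: "i0 \<in> {L..U}" "c i0 \<noteq> 0" using mem by blast
  have one: "\<bar>c i\<bar> \<le> 1" if "m = 1" "n = 1" for i
    using kl that by (auto simp: c_def e_def)
  obtain lo hi where "lo \<le> hi" "c lo \<noteq> 0" "c hi \<noteq> 0"
    "T lo x [^] c lo \<in> generate G ((\<lambda>i. T i x) ` {lo<..hi})"
    "T hi x [^] c hi \<in> generate G ((\<lambda>i. T i x) ` {lo..<hi})"
    using extreme_terms_of_relation[OF x rel i0] by blast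
  then show thesis
    using one[of lo] one[of hi] by (intro that[of lo hi "c lo" "c hi"]) auto
qed

text \<open>If \<open>p\<close> and \<open>q\<close> are the lowest and highest coefficients of a polynomial of degree \<open>d\<close> that kills
  \<open>x\<close>, then multiplication by \<open>p q\<close> brings \<open>t\<^sup>d\<^sup>+\<^sup>1 x\<close> and \<open>t\<^sup>-\<^sup>1 x\<close> back into the span of
  \<open>x, \<dots>, t\<^sup>d x\<close>. So the orbit of \<open>x\<close> lies in a finitely generated group up to powers of a fixed
  denominator \<open>D\<close>, which is 1 if the outer coefficients are units.\<close>

lemma orbit_fractions:
  fixes m n k l :: int
  assumes x: "x \<in> carrier G" and kl: "0 < k" "0 < l" "k \<noteq> l"
    and mn: "m \<noteq> 0 \<or> n \<noteq> 0"
    and eq: "(x \<otimes> T k x) [^] m = T j (x \<otimes> T l x) [^] n"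
  obtains X :: "'a set" and D :: int where "finite X" "X \<subseteq> carrier G" "D \<ge> 1"
    "m = 1 \<Longrightarrow> n = 1 \<Longrightarrow> D = 1"
    "\<And>j. \<exists>N::nat. T j x [^] (D ^ N) \<in> generate G X"
proof -
  obtain lo hi p q :: int where lohi: "lo \<le> hi" and pq: "p \<noteq> 0" "q \<noteq> 0"
    and unit: "m = 1 \<Longrightarrow> n = 1 \<Longrightarrow> \<bar>p\<bar> = 1 \<and> \<bar>q\<bar> = 1"
    and bot: "T lo x [^] p \<in> generate G ((\<lambda>i. T i x) ` {lo<..hi})"
    and top: "T hi x [^] q \<in> generate G ((\<lambda>i. T i x) ` {lo..<hi})"
    using relation_of_dependent_sums[OF assms] by blast
  define d where "d = hi - lo"
  define X where "X = (\<lambda>i. T i x) ` {0..d}"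
  define D where "D = \<bar>p * q\<bar>"
  have d: "d \<ge> 0" using lohi by (simp add: d_def)
  have X: "finite X" "X \<subseteq> carrier G" using x by (auto simp: X_def)
  have sub: "subgroup (generate G X) G" using X by (simp add: generate_is_subgroup)
  have shift: "T i x [^] r \<in> generate G X"
    if "T s x [^] r \<in> generate G ((\<lambda>i. T i x) ` I)" "(+) (i - s) ` I \<subseteq> {0..d}" for i s I and r :: int
  proof -
    have "T (i - s) (T s x [^] r) \<in> generate G (T (i - s) ` (\<lambda>i. T i x) ` I)"
      using that(1) x by (intro T_generate) auto
    moreover have "T (i - s) ` (\<lambda>i. T i x) ` I \<subseteq> X"
      using that(2) x by (auto simp: X_def T_T)
    ultimately show ?thesis
      using mono_generate[of "T (i - s) ` (\<lambda>i. T i x) ` I" X] x by (auto simp: T_pow T_T)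
  qed
  have "T (-1) x [^] p \<in> generate G X"
    by (rule shift[OF bot]) (auto simp: d_def)
  moreover have "T (d + 1) x [^] q \<in> generate G X"
    by (rule shift[OF top]) (auto simp: d_def)
  moreover have "p dvd D" "q dvd D" by (auto simp: D_def)
  ultimately have ends: "T (-1) x [^] D \<in> generate G X" "T (d + 1) x [^] D \<in> generate G X"
    using x by (auto intro: subgroup_int_pow_dvd[OF sub])
  have step: "T s u [^] D \<in> generate G X" if s: "s \<in> {1, -1}" and u: "u \<in> generate G X" for s u
  proof -
    have "T s u [^] D \<in> generate G X" if uX: "u \<in> X" for u
    proof -
      obtain i where i: "i \<in> {0..d}" "u = T i x" using uX unfolding X_def by blast
      then have u: "T s u = T (i + s) x" using x by (simp add: T_T add.commute)
      show ?thesis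
      proof (cases "i + s \<in> {0..d}")
        case True
        then have "T s u \<in> X" unfolding u X_def by blast
        then show ?thesis
          by (intro subgroup_int_pow_closed[OF sub] generate.incl)
      next
        case False
        then have "i + s = -1 \<or> i + s = d + 1" using s i by auto
        then show ?thesis unfolding u using ends by auto
      qed
    qed
    then have sX: "X \<subseteq> {u \<in> carrier G. T s u [^] D \<in> generate G X}"
      using X by auto
    have sg: "subgroup {u \<in> carrier G. T s u [^] D \<in> generate G X} G"
    proof (rule subgroupI)
      show "{u \<in> carrier G. T s u [^] D \<in> generate G X} \<noteq> {}"
        by (auto intro!: exI[of _ \<one>] simp: T_one generate.one)
    qed (auto simp: T_inv T_mult int_pow_distrib int_pow_inv subgroup.m_inv_closed[OF sub] generate.eng)
    show ?thesis
      using generate_subgroup_incl[OF sX sg] u by auto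
  qed
  have steps: "T (s * int N) u [^] (D ^ N) \<in> generate G X"
    if s: "s \<in> {1, -1}" and u: "u \<in> generate G X" for s u and N :: nat
  proof (induction N)
    case 0
    then show ?case using u generate_incl[OF X(2)] by (auto simp: T_0)
  next
    case (Suc N)
    have uc: "u \<in> carrier G" using u generate_incl[OF X(2)] by blast
    have "T s (T (s * int N) u [^] (D ^ N)) [^] D \<in> generate G X"
      using step[OF s Suc] .
    moreover have "s * int (Suc N) = s + s * int N" by (simp add: algebra_simps)
    ultimately show ?case using uc
      by (simp add: T_pow T_T int_pow_pow mult.commute)
  qed
  have xX: "x \<in> generate G X"
  proof -
    have "T 0 x \<in> X" using d by (auto simp: X_def)
    then show ?thesis using x by (simp add: T_0 generate.incl)
  qed
  show thesis
  proof (rule that[OF X])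
    show "D \<ge> 1" using pq unfolding D_def by (simp add: int_one_le_iff_zero_less)
    show "D = 1" if "m = 1" "n = 1" using unit[OF that] unfolding D_def by (simp add: abs_mult)
    show "\<exists>N. T j x [^] (D ^ N) \<in> generate G X" for j
    proof (cases "j \<ge> 0")
      case True
      then show ?thesis using steps[of 1 x "nat j"] xX by auto
    next
      case False
      then show ?thesis using steps[of "-1" x "nat (-j)"] xX by auto
    qed
  qed
qed

text \<open>The pigeonhole principle, applied to the infinitely many elements \<open>x + t\<^sup>k x\<close>.\<close>

lemma recurrent_sums:
  assumes x: "x \<in> carrier G" and fin: "finite \<L>"
    and cover: "\<And>a. a \<in> carrier G \<Longrightarrow> \<exists>j. \<exists>L\<in>\<L>. T j a \<in> L"
  obtains k l i j L where "0 < k" "0 < l" "k \<noteq> l" "L \<in> \<L>"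
    "T i (x \<otimes> T k x) \<in> L" "T j (x \<otimes> T l x) \<in> L"
proof -
  define P where "P k L \<longleftrightarrow> L \<in> \<L> \<and> (\<exists>j. T j (x \<otimes> T k x) \<in> L)" for k L
  have "\<exists>L. P k L" for k
    using cover[of "x \<otimes> T k x"] x by (auto simp: P_def)
  then obtain f where f: "\<And>k. P k (f k)" by metis
  have "finite (f ` {0<..})"
    using fin f by (auto simp: P_def intro: finite_subset)
  then have "\<not> inj_on f {0<..}"
    using infinite_Ioi finite_imageD by blast
  then obtain k l where kl: "k > 0" "l > 0" "k \<noteq> l" "f k = f l"
    by (auto simp: inj_on_def)
  then show thesis
    using that[of k l "f k"] f[of k] f[of l] unfolding P_def by metis
qed

text \<open>The covering sets are single elements here, so two of the \<open>x + t\<^sup>k x\<close> are equal up to a shift. The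
  resulting relation has unit outer coefficients and the orbit of \<open>x\<close> spans a finitely generated
  torsion group, which is finite.\<close>

lemma finite_of_torsion_orbit_cover:
  assumes "finite W" and W: "W \<subseteq> carrier G"
    and tors: "\<And>x. x \<in> carrier G \<Longrightarrow> \<exists>e::int. e > 0 \<and> x [^] e = \<one>"
    and cover: "\<And>a. a \<in> carrier G \<Longrightarrow> \<exists>j. T j a \<in> W"
  shows "finite (carrier G)"
proof -
  have orb: "finite (range (\<lambda>j. T j x))" if x: "x \<in> carrier G" for x
  proof -
    have "\<exists>j. \<exists>L\<in>(\<lambda>u. {u}) ` W. T j a \<in> L" if "a \<in> carrier G" for a
      using cover[OF that] by auto
    then obtain k l i j L where kl: "0 < k" "0 < l" "k \<noteq> l" and L: "L \<in> (\<lambda>u. {u}) ` W"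
      "T i (x \<otimes> T k x) \<in> L" "T j (x \<otimes> T l x) \<in> L"
      using recurrent_sums[OF x finite_imageI[OF \<open>finite W\<close>]] by metis
    have "T i (x \<otimes> T k x) = T j (x \<otimes> T l x)" using L by auto
    then have "T (-i) (T i (x \<otimes> T k x)) = T (-i) (T j (x \<otimes> T l x))" by simp
    then have eq: "(x \<otimes> T k x) [^] (1::int) = T (j - i) (x \<otimes> T l x) [^] (1::int)"
      using x by (simp add: T_T T_0)
    obtain X :: "'a set" and D :: int where X: "finite X" "X \<subseteq> carrier G" "D = 1"
      and gen: "\<And>j. \<exists>N::nat. T j x [^] (D ^ N) \<in> generate G X"
      using orbit_fractions[OF x kl _ eq] by (metis zero_neq_one)
    have "T j x \<in> generate G X" for j
      using gen[of j] X x by auto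
    moreover have "finite (generate G X)"
      using X tors by (intro finite_generate_torsion) auto
    ultimately show ?thesis by (meson finite_subset image_subsetI)
  qed
  have "carrier G \<subseteq> (\<Union>w\<in>W. range (\<lambda>j. T j w))"
  proof
    fix a assume a: "a \<in> carrier G"
    then obtain j where j: "T j a \<in> W" using cover by blast
    have "a = T (-j) (T j a)" using a by (simp add: T_T T_0)
    then show "a \<in> (\<Union>w\<in>W. range (\<lambda>j. T j w))" using j by blast
  qed
  then show ?thesis
    using orb W \<open>finite W\<close> by (meson finite_UN_I finite_subset subsetD)
qed

text \<open>Each member of \<open>\<L>\<close> is contained in a finitely generated group, so \<open>A\<close> is a finitely generated
  \<open>\<int>[t, 1/t]\<close>-module; the product of the denominators of the generators serves all of \<open>A\<close>.\<close>

lemma common_denominator: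
  assumes fin: "finite \<L>" and L: "\<And>L. L \<in> \<L> \<Longrightarrow> L \<subseteq> carrier G"
    and fg: "\<And>L. L \<in> \<L> \<Longrightarrow> \<exists>S\<subseteq>L. finite S \<and> L \<subseteq> generate G S"
    and dep: "\<And>L u v. L \<in> \<L> \<Longrightarrow> u \<in> L \<Longrightarrow> v \<in> L \<Longrightarrow>
      \<exists>(m::int) (n::int). (m \<noteq> 0 \<or> n \<noteq> 0) \<and> u [^] m = v [^] n"
    and cover: "\<And>a. a \<in> carrier G \<Longrightarrow> \<exists>j. \<exists>L\<in>\<L>. T j a \<in> L"
  obtains X and D :: int where "finite X" "X \<subseteq> carrier G" "D \<ge> 1"
    "\<And>a. a \<in> carrier G \<Longrightarrow> \<exists>N::nat. a [^] (D ^ N) \<in> generate G X"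
proof -
  obtain S where S: "\<And>L. L \<in> \<L> \<Longrightarrow> S L \<subseteq> L \<and> finite (S L) \<and> L \<subseteq> generate G (S L)"
    using fg by metis
  define Z where "Z = (\<Union>L\<in>\<L>. S L)"
  have Z: "finite Z" "Z \<subseteq> carrier G"
    using S L fin unfolding Z_def by blast+
  define P where "P x X D \<longleftrightarrow> finite X \<and> X \<subseteq> carrier G \<and> (D::int) \<ge> 1 \<and>
      (\<forall>j. \<exists>N::nat. T j x [^] (D ^ N) \<in> generate G X)" for x X D
  have ex: "\<exists>X D. P x X D" if "x \<in> Z" for x
  proof -
    have x: "x \<in> carrier G" using that Z by blast
    obtain k l i j L where kl: "0 < k" "0 < l" "k \<noteq> l" and L: "L \<in> \<L>"
      "T i (x \<otimes> T k x) \<in> L" "T j (x \<otimes> T l x) \<in> L"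
      by (rule recurrent_sums[OF x fin cover])
    obtain m n :: int where mn: "m \<noteq> 0 \<or> n \<noteq> 0"
      and "T i (x \<otimes> T k x) [^] m = T j (x \<otimes> T l x) [^] n"
      using dep[OF L] by blast
    then have "T (-i) (T i (x \<otimes> T k x) [^] m) = T (-i) (T j (x \<otimes> T l x) [^] n)" by simp
    then have eq: "(x \<otimes> T k x) [^] m = T (j - i) (x \<otimes> T l x) [^] n"
      using x by (simp add: T_T T_0 T_pow)
    show ?thesis
      by (rule orbit_fractions[OF x kl mn eq]) (auto simp: P_def)
  qed
  then obtain X D where "\<And>x. x \<in> Z \<Longrightarrow> P x (X x) (D x)" by metis
  then have XD: "finite (X x) \<and> X x \<subseteq> carrier G \<and> D x \<ge> 1 \<and>
      (\<forall>j. \<exists>N::nat. T j x [^] (D x ^ N) \<in> generate G (X x))" if "x \<in> Z" for x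
    using that unfolding P_def by blast
  define Y where "Y = (\<Union>x\<in>Z. X x)"
  define E where "E = (\<Prod>x\<in>Z. D x)"
  have Y: "finite Y" "Y \<subseteq> carrier G" using XD Z by (auto simp: Y_def)
  have E: "E \<ge> 1" unfolding E_def using XD by (meson prod_ge_1)
  have sub: "subgroup (generate G Y) G" using Y by (simp add: generate_is_subgroup)
  define H where "H = {a \<in> carrier G. \<exists>N::nat. a [^] (E ^ N) \<in> generate G Y}"
  have up: "a [^] (E ^ N) \<in> generate G Y" if "a [^] (E ^ M) \<in> generate G Y" "M \<le> N" "a \<in> carrier G"
    for a M N
  proof -
    have "E ^ M dvd E ^ N" using that(2) by (rule le_imp_power_dvd)
    then show ?thesis by (rule subgroup_int_pow_dvd[OF sub that(3) that(1)])
  qed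
  have "subgroup H G"
  proof (rule subgroupI)
    show "H \<subseteq> carrier G" by (auto simp: H_def)
    show "H \<noteq> {}" by (auto simp: H_def generate.one intro!: exI[of _ \<one>])
    show "inv a \<in> H" if "a \<in> H" for a
      using that subgroup.m_inv_closed[OF sub] by (force simp: H_def int_pow_inv)
    show "a \<otimes> b \<in> H" if ab: "a \<in> H" "b \<in> H" for a b
    proof -
      obtain M N :: nat where "a [^] (E ^ M) \<in> generate G Y" "b [^] (E ^ N) \<in> generate G Y"
        using ab by (auto simp: H_def)
      then have "a [^] (E ^ max M N) \<in> generate G Y" "b [^] (E ^ max M N) \<in> generate G Y"
        using up that by (auto simp: H_def)
      then have "(a \<otimes> b) [^] (E ^ max M N) \<in> generate G Y"
        using that by (auto simp: H_def int_pow_distrib intro: generate.eng)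
      then show ?thesis using that by (auto simp: H_def)
    qed
  qed
  have TZ: "T j x \<in> H" if x: "x \<in> Z" for x j
  proof -
    obtain N :: nat where N: "T j x [^] (D x ^ N) \<in> generate G (X x)" using XD[OF x] by blast
    have "D x dvd E" unfolding E_def using x Z by (intro dvd_prodI)
    then have "D x ^ N dvd E ^ N" by (rule dvd_power_same)
    moreover have "T j x [^] (D x ^ N) \<in> generate G Y"
      using N x mono_generate[of "X x" Y] by (auto simp: Y_def)
    moreover have "T j x \<in> carrier G" using x Z by auto
    ultimately show ?thesis
      using subgroup_int_pow_dvd[OF sub] unfolding H_def by blast
  qed
  have "a \<in> H" if a: "a \<in> carrier G" for a
  proof -
    obtain j L where j: "L \<in> \<L>" "T j a \<in> L" using cover[OF a] by blast
    then have "T j a \<in> generate G (S L)" using S by blast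
    then have "T (-j) (T j a) \<in> generate G (T (-j) ` S L)"
      using S[OF j(1)] L[OF j(1)] by (intro T_generate) auto
    moreover have "T (-j) ` S L \<subseteq> H"
      using TZ j(1) by (auto simp: Z_def)
    ultimately show ?thesis
      using generate_subgroup_incl[OF _ \<open>subgroup H G\<close>] a by (auto simp: T_T T_0)
  qed
  then show thesis using that[OF Y E] by (auto simp: H_def)
qed

section \<open>Too many orbits on finite quotients\<close>

text \<open>The existence of a basis is replaced by minimality: if a multiple of \<open>y \<in> Y\<close> were in the span of
  the other elements, then \<open>y\<close> could be dropped at the price of a larger denominator. Only an
  element of infinite order prevents the minimal set from being empty.\<close>

lemma independent_denominator:
  assumes fin: "finite X" "X \<subseteq> carrier G" and D: "(D::int) \<ge> 1"
    and den: "\<And>a. a \<in> carrier G \<Longrightarrow> \<exists>N::nat. a [^] (D ^ N) \<in> generate G X"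
    and nontors: "z \<in> carrier G" "\<And>e::int. e > 0 \<Longrightarrow> z [^] e \<noteq> \<one>"
  obtains Y y and E :: int where "finite Y" "Y \<subseteq> carrier G" "E \<ge> 1" "y \<in> Y"
    "\<And>a. a \<in> carrier G \<Longrightarrow> \<exists>N::nat. a [^] (E ^ N) \<in> generate G Y"
    "\<And>m::int. y [^] m \<in> generate G (Y - {y}) \<Longrightarrow> m = 0"
proof -
  define P where "P X \<longleftrightarrow> finite X \<and> X \<subseteq> carrier G \<and>
    (\<exists>D::int. D \<ge> 1 \<and> (\<forall>a\<in>carrier G. \<exists>N::nat. a [^] (D ^ N) \<in> generate G X))" for X
  have "P X" using fin D den by (auto simp: P_def)
  then obtain Y where Y: "P Y" and min: "\<And>Z. P Z \<Longrightarrow> card Y \<le> card Z"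
    using ex_has_least_nat[of P X card] by blast
  obtain E :: int where E: "E \<ge> 1" "\<And>a. a \<in> carrier G \<Longrightarrow> \<exists>N::nat. a [^] (E ^ N) \<in> generate G Y"
    using Y unfolding P_def by blast
  have Yf: "finite Y" "Y \<subseteq> carrier G" using Y by (auto simp: P_def)
  have "Y \<noteq> {}"
  proof
    assume "Y = {}"
    then obtain N :: nat where "z [^] (E ^ N) = \<one>"
      using E(2)[OF nontors(1)] by (auto simp: generate_empty)
    moreover have "E ^ N > 0" using E(1) by simp
    ultimately show False using nontors(2) by blast
  qed
  then obtain y where y: "y \<in> Y" by blast
  have yc: "y \<in> carrier G" using y Yf by blast
  have indep: "m = 0" if m: "y [^] m \<in> generate G (Y - {y})" for m :: int
  proof (rule ccontr)
    assume "m \<noteq> 0"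
    let ?Z = "Y - {y}"
    have Zc: "?Z \<subseteq> carrier G" using Yf by blast
    have sub: "subgroup (generate G ?Z) G" using Zc by (rule generate_is_subgroup)
    have "\<exists>N::nat. a [^] ((E * \<bar>m\<bar>) ^ N) \<in> generate G ?Z" if a: "a \<in> carrier G" for a
    proof -
      obtain N :: nat where "a [^] (E ^ N) \<in> generate G Y" using E(2)[OF a] by blast
      then have "a [^] (E ^ N) \<in> generate G (insert y ?Z)" using y by (simp add: insert_absorb)
      then obtain i w where w: "a [^] (E ^ N) = y [^] (i::int) \<otimes> w" "w \<in> generate G ?Z"
        using generate_insert[OF yc Zc] by auto
      have wc: "w \<in> carrier G" using w generate_incl[OF Zc] by blast
      have "a [^] (E ^ N * \<bar>m\<bar>) = (y [^] (i::int) \<otimes> w) [^] \<bar>m\<bar>"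
        using a w(1) by (simp add: int_pow_pow[symmetric])
      also have "\<dots> = y [^] (i * \<bar>m\<bar>) \<otimes> w [^] \<bar>m\<bar>"
        using yc wc by (simp add: int_pow_distrib int_pow_pow)
      also have "\<dots> \<in> generate G ?Z"
        using w(2) by (intro generate.eng subgroup_int_pow_closed[OF sub]
            subgroup_int_pow_dvd[OF sub yc m]) auto
      finally have "a [^] (E ^ N * \<bar>m\<bar>) \<in> generate G ?Z" .
      moreover have "E ^ N * \<bar>m\<bar> dvd (E * \<bar>m\<bar>) ^ Suc N"
        by (simp add: power_mult_distrib algebra_simps)
      ultimately show ?thesis using subgroup_int_pow_dvd[OF sub a] by blast
    qed
    moreover have "E * \<bar>m\<bar> \<ge> 1" using E(1) \<open>m \<noteq> 0\<close>
      using mult_mono[of 1 E 1 "\<bar>m\<bar>"] by simp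
    ultimately have "P ?Z" using Yf unfolding P_def by blast
    then have "card Y \<le> card ?Z" by (rule min)
    then show False using y Yf by (metis card_Diff1_less not_le)
  qed
  show thesis by (rule that[OF Yf E(1) y E(2) indep])
qed

text \<open>The count of orbits. Take \<open>q = D + 1\<close>, which is coprime to the denominator \<open>D\<close>, and \<open>Q = q\<^sup>C\<close>.
  Then \<open>A/QA\<close> is generated by the image of the finite set \<open>Y\<close>, hence finite, and some \<open>t\<^sup>n\<close> with
  \<open>n > 0\<close> acts trivially on it. The elements \<open>q\<^sup>C\<^sup>-\<^sup>i y\<close> for \<open>0 \<le> i \<le> C\<close> have different orders
  \<open>q\<^sup>i\<close> in \<open>A/QA\<close>, because \<open>y\<close> is independent of the rest of \<open>Y\<close> and \<open>q\<close> is coprime to \<open>D\<close>.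
  The order is constant on orbits of \<open>t\<close> on this quotient, whereas \<open>few\<close> allows only \<open>C\<close> orbits.\<close>

lemma no_independent_denominator:
  fixes C :: nat
  assumes Y: "finite Y" "Y \<subseteq> carrier G" and D: "(D::int) \<ge> 1"
    and den: "\<And>a. a \<in> carrier G \<Longrightarrow> \<exists>N::nat. a [^] (D ^ N) \<in> generate G Y"
    and y: "y \<in> Y" and indep: "\<And>m::int. y [^] m \<in> generate G (Y - {y}) \<Longrightarrow> m = 0"
    and few: "\<And>n. n > 0 \<Longrightarrow> \<exists>B. finite B \<and> B \<subseteq> carrier G \<and> card B \<le> C \<and>
      (\<forall>a\<in>carrier G. \<exists>j. \<exists>b\<in>carrier G. \<exists>\<beta>\<in>B. T j a = \<beta> \<otimes> (T n b \<otimes> inv b))"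
  shows False
proof -
  define q where "q = D + 1"
  define Q where "Q = q ^ C"
  have q: "q \<ge> 2" "coprime D q"
    using D by (auto simp: q_def)
  have Q: "Q > 0" using q by (simp add: Q_def)
  define H where "H = {a [^] Q | a. a \<in> carrier G}"
  have Hc: "H \<subseteq> carrier G" by (auto simp: H_def)
  have H: "subgroup H G"
  proof (rule subgroupI)
    show "H \<subseteq> carrier G" by (auto simp: H_def)
    show "H \<noteq> {}" by (auto simp: H_def)
    show "inv a \<in> H" if "a \<in> H" for a
      using that by (auto simp: H_def int_pow_inv[symmetric])
    show "a \<otimes> b \<in> H" if "a \<in> H" "b \<in> H" for a b
      using that by (auto simp: H_def int_pow_distrib[symmetric])
  qed
  have TH: "T j h \<in> H" if "h \<in> H" for j h
    using that by (auto simp: H_def T_pow)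
  have yc: "y \<in> carrier G" and Zc: "Y - {y} \<subseteq> carrier G" using y Y by auto
  have split: "\<exists>w\<in>generate G Y. \<exists>h\<in>H. a = w \<otimes> h" if a: "a \<in> carrier G" for a
  proof -
    \<comment> \<open>A Bezout identity for the coprime numbers \<open>D\<^sup>N\<close> and \<open>Q\<close> splits \<open>a\<close> into a part in the span
      of \<open>Y\<close> and a multiple of \<open>Q\<close>.\<close>
    obtain N :: nat where N: "a [^] (D ^ N) \<in> generate G Y" using den[OF a] by blast
    have "coprime (D ^ N) Q" using q by (simp add: Q_def)
    then obtain u v where uv: "u * D ^ N + v * Q = 1"
      by (metis bezout_int coprime_imp_gcd_eq_1)
    have "a = a [^] (D ^ N * u + v * Q)" using uv a by (simp add: mult.commute)
    also have "\<dots> = (a [^] (D ^ N)) [^] u \<otimes> (a [^] v) [^] Q"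
      using a by (simp only: int_pow_mult int_pow_pow)
    finally have "a = (a [^] (D ^ N)) [^] u \<otimes> (a [^] v) [^] Q" .
    moreover have "(a [^] (D ^ N)) [^] u \<in> generate G Y"
      using subgroup_int_pow_closed[OF generate_is_subgroup[OF Y(2)] N] .
    moreover have "(a [^] v) [^] Q \<in> H" using a by (auto simp: H_def)
    ultimately show ?thesis by blast
  qed
  interpret nH: normal H G using H by (rule subgroup_imp_normal)
  interpret F: comm_group "G Mod H" using H by (rule abelian_FactGroup)
  interpret \<pi>: group_hom G "G Mod H" "\<lambda>a. H #> a"
    by (simp add: group_hom_def group_hom_axioms_def is_group F.is_group nH.r_coset_hom_Mod)
  have \<pi>H: "H #> h = H" if "h \<in> H" for h
    using coset_join2[OF _ H that] Hc that by blast
  have fin: "finite (carrier (G Mod H))"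
  proof -
    have "carrier (G Mod H) \<subseteq> generate (G Mod H) ((\<lambda>a. H #> a) ` Y)"
    proof
      fix c assume "c \<in> carrier (G Mod H)"
      then obtain a where a: "a \<in> carrier G" "c = H #> a" by (auto simp: carrier_FactGroup)
      obtain w h where wh: "w \<in> generate G Y" "h \<in> H" "a = w \<otimes> h" using split[OF a(1)] by blast
      have wc: "w \<in> carrier G" using wh generate_incl[OF Y(2)] by blast
      then have "c = (H #> w) \<otimes>\<^bsub>G Mod H\<^esub> (H #> h)"
        using a wh Hc \<pi>.hom_mult[of w h] by auto
      also have "\<dots> = H #> w"
        using \<pi>H[OF wh(2)] F.r_one[of "H #> w"] wc by (simp add: carrier_FactGroup)
      finally have "c = H #> w" .
      then show "c \<in> generate (G Mod H) ((\<lambda>a. H #> a) ` Y)"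
        using \<pi>.generate_img[OF Y(2)] wh by auto
    qed
    moreover have "finite (generate (G Mod H) ((\<lambda>a. H #> a) ` Y))"
    proof (rule F.finite_generate_torsion)
      show "finite ((\<lambda>a. H #> a) ` Y)" using Y by blast
      show "(\<lambda>a. H #> a) ` Y \<subseteq> carrier (G Mod H)" using Y by (auto simp: carrier_FactGroup)
      fix c assume "c \<in> (\<lambda>a. H #> a) ` Y"
      then obtain a where a: "a \<in> carrier G" "c = H #> a" using Y by blast
      have "c [^]\<^bsub>G Mod H\<^esub> Q = H #> (a [^] Q)"
        using a \<pi>.hom_int_pow[of a Q] by simp
      moreover have "a [^] Q \<in> H" using a(1) unfolding H_def by blast
      then have "H #> (a [^] Q) = \<one>\<^bsub>G Mod H\<^esub>" using \<pi>H by simp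
      ultimately show "\<exists>e::int. e > 0 \<and> c [^]\<^bsub>G Mod H\<^esub> e = \<one>\<^bsub>G Mod H\<^esub>" using Q by auto
    qed
    ultimately show ?thesis by (rule finite_subset)
  qed
  have quot: "a \<otimes> inv b \<in> H" if "H #> a = H #> b" "a \<in> carrier G" "b \<in> carrier G" for a b
    using that nH.rcos_module[OF is_group, of b a] rcos_self[OF that(2) H] by auto
  obtain n where n: "n > 0" "\<And>u. u \<in> Y \<Longrightarrow> T n u \<otimes> inv u \<in> H"
  proof -
    \<comment> \<open>The pigeonhole principle for the classes of \<open>t\<^sup>k u\<close>, simultaneously for all \<open>u \<in> Y\<close>.\<close>
    define f where "f k = (\<lambda>u\<in>Y. H #> T (int k) u)" for k :: nat
    have "range f \<subseteq> Y \<rightarrow>\<^sub>E carrier (G Mod H)"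
      using Y by (auto simp: f_def carrier_FactGroup)
    then have "finite (range f)" using finite_PiE[OF Y(1)] fin by (meson finite_subset)
    then have "\<not> inj f" using infinite_UNIV_nat finite_imageD by blast
    then obtain k l where kl: "k < l" "f k = f l"
      by (metis injI nat_neq_iff)
    have "T (int l - int k) u \<otimes> inv u \<in> H" if u: "u \<in> Y" for u
    proof -
      have uc: "u \<in> carrier G" using u Y by blast
      have "H #> T (int l) u = H #> T (int k) u"
        using kl(2) u by (metis f_def restrict_apply')
      then have "T (int l) u \<otimes> inv (T (int k) u) \<in> H" using uc by (intro quot) auto
      then have "T (- int k) (T (int l) u \<otimes> inv (T (int k) u)) \<in> H" by (rule TH)
      then show ?thesis using uc by (simp add: T_mult T_inv T_T T_0)
    qed
    then show thesis using that[of "int l - int k"] kl by auto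
  qed
  have triv: "T n a \<otimes> inv a \<in> H" if a: "a \<in> carrier G" for a
  proof -
    let ?K = "{a \<in> carrier G. T n a \<otimes> inv a \<in> H}"
    have K: "subgroup ?K G"
    proof (rule subgroupI)
      show "?K \<noteq> {}" using subgroup.one_closed[OF H] by (auto intro!: exI[of _ \<one>] simp: T_one)
      show "inv a \<in> ?K" if "a \<in> ?K" for a
      proof -
        have "inv (T n a \<otimes> inv a) \<in> H" using that subgroup.m_inv_closed[OF H] by blast
        then show ?thesis using that by (simp add: T_inv inv_mult m_comm)
      qed
      show "a \<otimes> b \<in> ?K" if "a \<in> ?K" "b \<in> ?K" for a b
      proof -
        have "(T n a \<otimes> inv a) \<otimes> (T n b \<otimes> inv b) \<in> H" using that subgroup.m_closed[OF H] by blast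
        then show ?thesis using that by (simp add: T_mult inv_mult m_ac)
      qed
    qed auto
    have "Y \<subseteq> ?K" using n Y by auto
    then have "generate G Y \<subseteq> ?K" using generate_subgroup_incl[OF _ K] by blast
    moreover have "H \<subseteq> ?K" using Hc TH H by (auto simp: subgroup.m_closed subgroup.m_inv_closed)
    ultimately show ?thesis using split[OF a] subgroup.m_closed[OF K] by blast
  qed
  obtain B where B: "finite B" "B \<subseteq> carrier G" "card B \<le> C"
    "\<And>a. a \<in> carrier G \<Longrightarrow> \<exists>j. \<exists>b\<in>carrier G. \<exists>\<beta>\<in>B. T j a = \<beta> \<otimes> (T n b \<otimes> inv b)"
    using few[OF n(1)] by blast
  have near: "\<exists>j. \<exists>\<beta>\<in>B. \<exists>h\<in>H. T j a = \<beta> \<otimes> h" if "a \<in> carrier G" for a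
    using B(4)[OF that] triv by blast
  \<comment> \<open>Assign to each \<open>i \<le> C\<close> a representative \<open>\<beta>\<close> of the orbit of \<open>q\<^sup>C\<^sup>-\<^sup>i y\<close>; two indices
    share one.\<close>
  define P where "P i \<beta> \<longleftrightarrow> \<beta> \<in> B \<and> (\<exists>j. \<exists>h\<in>H. T j (y [^] (q ^ (C - i))) = \<beta> \<otimes> h)" for i :: nat and \<beta>
  have "\<exists>\<beta>. P i \<beta>" for i using near[of "y [^] (q ^ (C - i))"] yc by (auto simp: P_def)
  then obtain f where f: "\<And>i. P i (f i)" by metis
  have "\<not> inj_on f {0..C}"
  proof
    assume "inj_on f {0..C}"
    then have "card (f ` {0..C}) = Suc C" by (simp add: card_image)
    moreover have "f ` {0..C} \<subseteq> B" using f by (auto simp: P_def)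
    ultimately show False using B card_mono[OF B(1)] by (metis not_less_eq_eq le_trans)
  qed
  then obtain i i' where i: "i < i'" "i' \<le> C" "f i = f i'"
    unfolding inj_on_def by (metis atLeastAtMost_iff nat_neq_iff)
  define \<beta> where "\<beta> = f i"
  have \<beta>: "\<beta> \<in> carrier G" using f[of i] B by (auto simp: P_def \<beta>_def)
  have transfer: "a [^] r \<in> H \<longleftrightarrow> \<beta> [^] r \<in> H"
    if a: "a \<in> carrier G" and "T j a = \<beta> \<otimes> h" and h: "h \<in> H" for a j h and r :: int
  proof -
    have hr: "h [^] r \<in> H" "h [^] r \<in> carrier G" using subgroup_int_pow_closed[OF H h] Hc by auto
    have eq: "T j (a [^] r) = \<beta> [^] r \<otimes> h [^] r"
      using a that(2) \<beta> h Hc by (auto simp: T_pow int_pow_distrib)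
    have "T (-j) (T j (a [^] r)) = a [^] r" using a by (simp add: T_T T_0)
    then have "a [^] r \<in> H \<longleftrightarrow> T j (a [^] r) \<in> H"
      using TH[of "a [^] r" j] TH[of "T j (a [^] r)" "-j"] by auto
    also have "\<dots> \<longleftrightarrow> \<beta> [^] r \<in> H"
    proof
      assume "T j (a [^] r) \<in> H"
      then have "(\<beta> [^] r \<otimes> h [^] r) \<otimes> inv (h [^] r) \<in> H"
        unfolding eq by (rule subgroup.m_closed[OF H _ subgroup.m_inv_closed[OF H hr(1)]])
      then show "\<beta> [^] r \<in> H" using hr \<beta> by (simp add: m_assoc)
    qed (auto simp: eq intro: subgroup.m_closed[OF H] hr)
    finally show ?thesis .
  qed
  have pow_iff: "(y [^] (q ^ (C - i0))) [^] r \<in> H \<longleftrightarrow> \<beta> [^] r \<in> H"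
    if "i0 \<in> {i, i'}" for i0 and r :: int
  proof -
    have "P i0 \<beta>" using that f[of i] f[of i'] i by (auto simp: \<beta>_def)
    then show ?thesis using transfer[of "y [^] (q ^ (C - i0))"] yc by (auto simp: P_def)
  qed
  \<comment> \<open>For the smaller index \<open>i\<close> the multiple by \<open>q\<^sup>i\<close> vanishes modulo \<open>Q\<close>, hence it also does for
    \<open>i'\<close>, so that \<open>y\<close> has order less than \<open>Q\<close> in \<open>A/QA\<close>.\<close>
  have "(y [^] (q ^ (C - i))) [^] (q ^ i) \<in> H"
  proof -
    have "q ^ (C - i) * q ^ i = Q" using i by (simp add: Q_def power_add[symmetric])
    moreover have "y [^] Q \<in> H" using yc unfolding H_def by blast
    ultimately show ?thesis using yc by (simp add: int_pow_pow)
  qed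
  then have "(y [^] (q ^ (C - i'))) [^] (q ^ i) \<in> H" using pow_iff[of i "q ^ i"] pow_iff[of i' "q ^ i"] by simp
  then have "y [^] (q ^ (C - i' + i)) \<in> H" using yc by (simp add: int_pow_pow power_add)
  then obtain b where b: "b \<in> carrier G" "y [^] (q ^ (C - i' + i)) = b [^] Q" unfolding H_def by blast
  obtain N :: nat where N: "b [^] (D ^ N) \<in> generate G Y" using den[OF b(1)] by blast
  then have "b [^] (D ^ N) \<in> generate G (insert y (Y - {y}))" using y by (simp add: insert_absorb)
  then obtain u w where w: "b [^] (D ^ N) = y [^] (u::int) \<otimes> w" "w \<in> generate G (Y - {y})"
    using generate_insert[OF yc Zc] by auto
  have wc: "w \<in> carrier G" using w generate_incl[OF Zc] by blast
  have "y [^] (q ^ (C - i' + i) * D ^ N) = (b [^] Q) [^] (D ^ N)"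
    using yc b(2) by (simp add: int_pow_pow[symmetric])
  also have "\<dots> = (b [^] (D ^ N)) [^] Q" using b(1) by (simp add: int_pow_pow mult.commute)
  also have "\<dots> = y [^] (u * Q) \<otimes> w [^] Q" unfolding w(1) using yc wc by (simp add: int_pow_distrib int_pow_pow)
  finally have eq: "y [^] (q ^ (C - i' + i) * D ^ N) = y [^] (u * Q) \<otimes> w [^] Q" .
  have "y [^] (q ^ (C - i' + i) * D ^ N - u * Q) = w [^] Q"
    using eq yc wc by (simp add: int_pow_diff m_comm[of "y [^] (u * Q)"] m_assoc)
  then have "q ^ (C - i' + i) * D ^ N - u * Q = 0"
    using w(2) subgroup_int_pow_closed[OF generate_is_subgroup[OF Zc]] by (intro indep) simp
  then have "q ^ (C - i' + i) * D ^ N = q ^ (C - i' + i) * (u * q ^ (i' - i))"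
    using i by (simp add: Q_def power_add[symmetric] algebra_simps)
  then have "D ^ N = u * q ^ (i' - i)" using q by simp
  moreover have "q dvd q ^ (i' - i)" using i by simp
  ultimately have "q dvd D ^ N" by simp
  moreover have "coprime (D ^ N) q" using q by simp
  ultimately have "is_unit q" by (metis coprime_common_divisor dvd_refl)
  then show False using q by simp
qed

text \<open>In additive notation, the hypothesis \<open>few\<close> says that \<open>t\<close> has at most \<open>C\<close> orbits on \<open>A/(t\<^sup>n - 1)A\<close>
  for every \<open>n > 0\<close>. In the semidirect product of \<open>A\<close> with \<open>\<langle>t\<rangle>\<close> these orbits are the conjugacy
  classes in the coset \<open>A t\<^sup>n\<close>. The other hypotheses describe the covering of \<open>A\<close> by translates
  of finitely many subsets of virtually cyclic groups.\<close>

theorem finite_if_few_twisted_classes: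
  fixes C :: nat
  assumes fin: "finite \<L>" and L: "\<And>L. L \<in> \<L> \<Longrightarrow> L \<subseteq> carrier G"
    and fg: "\<And>L. L \<in> \<L> \<Longrightarrow> \<exists>S\<subseteq>L. finite S \<and> L \<subseteq> generate G S"
    and dep: "\<And>L u v. L \<in> \<L> \<Longrightarrow> u \<in> L \<Longrightarrow> v \<in> L \<Longrightarrow>
      \<exists>(m::int) (n::int). (m \<noteq> 0 \<or> n \<noteq> 0) \<and> u [^] m = v [^] n"
    and cover: "\<And>a. a \<in> carrier G \<Longrightarrow> \<exists>j. \<exists>L\<in>\<L>. T j a \<in> L"
    and few: "\<And>n. n > 0 \<Longrightarrow> \<exists>B. finite B \<and> B \<subseteq> carrier G \<and> card B \<le> C \<and>
      (\<forall>a\<in>carrier G. \<exists>j. \<exists>b\<in>carrier G. \<exists>\<beta>\<in>B. T j a = \<beta> \<otimes> (T n b \<otimes> inv b))"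
  shows "finite (carrier G)"
proof (cases "\<forall>x\<in>carrier G. \<exists>e::int. e > 0 \<and> x [^] e = \<one>")
  case True
  have "finite L" if LL: "L \<in> \<L>" for L
  proof -
    obtain S where "S \<subseteq> L" "finite S" "L \<subseteq> generate G S" using fg[OF LL] by blast
    moreover have "finite (generate G S)"
      using True L[OF LL] \<open>S \<subseteq> L\<close> \<open>finite S\<close> by (intro finite_generate_torsion) auto
    ultimately show ?thesis using finite_subset by blast
  qed
  then show ?thesis
    using fin L True cover by (intro finite_of_torsion_orbit_cover[of "\<Union>\<L>"]) auto
next
  case False
  then obtain z where z: "z \<in> carrier G" "\<And>e::int. e > 0 \<Longrightarrow> z [^] e \<noteq> \<one>" by blast
  obtain X and D :: int where X: "finite X" "X \<subseteq> carrier G" "D \<ge> 1"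
    "\<And>a. a \<in> carrier G \<Longrightarrow> \<exists>N::nat. a [^] (D ^ N) \<in> generate G X"
    by (rule common_denominator[OF fin L fg dep cover]) (assumption | rule that)+
  obtain Y y and E :: int where Y: "finite Y" "Y \<subseteq> carrier G" "E \<ge> 1" "y \<in> Y"
    "\<And>a. a \<in> carrier G \<Longrightarrow> \<exists>N::nat. a [^] (E ^ N) \<in> generate G Y"
    "\<And>m::int. y [^] m \<in> generate G (Y - {y}) \<Longrightarrow> m = 0"
    by (rule independent_denominator[OF X z]) (assumption | rule that)+
  have False
    by (rule no_independent_denominator[OF Y(1,2,3,5,4,6) few])
  then show ?thesis ..
qed

end

section \<open>Virtually cyclic subgroups\<close>

text \<open>All later arguments use a virtually cyclic subgroup in the form \<open>K = \<langle>c\<rangle> F\<close> with \<open>F\<close> finite.\<close>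

lemma (in group) VC_iff:
  "K \<in> VC G \<longleftrightarrow> subgroup K G \<and>
    (\<exists>c\<in>K. \<exists>F. finite F \<and> F \<subseteq> K \<and> K \<subseteq> {c [^] (i::int) \<otimes> f | i f. f \<in> F})"
proof (cases "subgroup K G")
  case True
  let ?K = "G\<lparr>carrier := K\<rparr>"
  interpret K: group ?K by (rule subgroup_imp_group[OF True])
  have pow: "c [^]\<^bsub>?K\<^esub> i = c [^] i" if "c \<in> K" for c and i :: int
    using int_pow_consistent[OF True that] by simp
  have "virtually_cyclic ?K \<longleftrightarrow>
    (\<exists>c\<in>K. \<exists>F. finite F \<and> F \<subseteq> K \<and> K \<subseteq> {c [^] (i::int) \<otimes> f | i f. f \<in> F})" (is "_ \<longleftrightarrow> ?R")
  proof
    assume "virtually_cyclic ?K"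
    then obtain C where C: "subgroup C ?K" "cyclic_group (?K\<lparr>carrier := C\<rparr>)" "finite (rcosets\<^bsub>?K\<^esub> C)"
      unfolding virtually_cyclic_def by blast
    interpret C: group "?K\<lparr>carrier := C\<rparr>" by (rule K.subgroup_imp_group[OF C(1)])
    obtain c where c: "c \<in> C" "C = range (\<lambda>n::int. c [^]\<^bsub>?K\<lparr>carrier := C\<rparr>\<^esub> n)"
      using C(2) C.cyclic_group by auto
    have cK: "c \<in> K" using c(1) subgroup.subset[OF C(1)] by auto
    have Cpow: "C = range (\<lambda>n::int. c [^] n)"
      using c K.int_pow_consistent[OF C(1) c(1)] pow[OF cK] by simp
    define r where "r U = (SOME x. x \<in> U)" for U :: "'a set"
    have r: "r U \<in> U \<and> U \<subseteq> K" if "U \<in> rcosets\<^bsub>?K\<^esub> C" for U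
    proof
      show "r U \<in> U" unfolding r_def
        using subgroup.rcosets_non_empty[OF C(1) that] by (metis ex_in_conv someI)
      show "U \<subseteq> K" using K.rcosets_subset_PowG[OF C(1)] that by auto
    qed
    have "K \<subseteq> {c [^] (i::int) \<otimes> f | i f. f \<in> r ` (rcosets\<^bsub>?K\<^esub> C)}"
    proof
      fix x assume x: "x \<in> K"
      define U where "U = C #>\<^bsub>?K\<^esub> x"
      have U: "U \<in> rcosets\<^bsub>?K\<^esub> C"
        using x K.rcosetsI[of C x] subgroup.subset[OF C(1)] by (auto simp: U_def)
      have xU: "x \<in> U" using K.rcos_self[of x C] C(1) x by (simp add: U_def)
      have "r U \<in> C #>\<^bsub>?K\<^esub> x" using r[OF U] by (simp add: U_def)
      then obtain i :: int where i: "r U = c [^] i \<otimes> x"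
        using Cpow by (auto simp: r_coset_def)
      have "x = c [^] (-i) \<otimes> r U"
        unfolding i using cK x subgroup.subset[OF True]
        by (simp add: int_pow_neg m_assoc[symmetric] subsetD)
      then show "x \<in> {c [^] (i::int) \<otimes> f | i f. f \<in> r ` (rcosets\<^bsub>?K\<^esub> C)}" using U by blast
    qed
    moreover have "r ` (rcosets\<^bsub>?K\<^esub> C) \<subseteq> K" using r by blast
    ultimately show ?R using C(3) cK by (meson finite_imageI)
  next
    assume ?R
    then obtain c F where c: "c \<in> K" and F: "finite F" "F \<subseteq> K" "K \<subseteq> {c [^] (i::int) \<otimes> f | i f. f \<in> F}"
      by blast
    define C where "C = range (\<lambda>n::int. c [^] n)"
    have gen: "C = generate ?K {c}"
      using K.generate_pow[of c] c pow[OF c] by (auto simp: C_def)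
    have C: "subgroup C ?K" unfolding gen using c by (intro K.generate_is_subgroup) auto
    interpret C: group "?K\<lparr>carrier := C\<rparr>" by (rule K.subgroup_imp_group[OF C])
    have cC: "c \<in> C" unfolding gen by (simp add: generate.incl)
    have "c [^]\<^bsub>?K\<lparr>carrier := C\<rparr>\<^esub> n = c [^] n" for n :: int
      using K.int_pow_consistent[OF C cC, of n] pow[OF c, of n] by simp
    then have "carrier (?K\<lparr>carrier := C\<rparr>) = range (\<lambda>n::int. c [^]\<^bsub>?K\<lparr>carrier := C\<rparr>\<^esub> n)"
      by (simp add: C_def[symmetric])
    moreover have "c \<in> carrier (?K\<lparr>carrier := C\<rparr>)" using cC by simp
    ultimately have "cyclic_group (?K\<lparr>carrier := C\<rparr>)"
      unfolding C.cyclic_group by blast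
    moreover have "finite (rcosets\<^bsub>?K\<^esub> C)"
    proof -
      have "rcosets\<^bsub>?K\<^esub> C \<subseteq> (\<lambda>f. C #>\<^bsub>?K\<^esub> f) ` F"
      proof
        fix U assume "U \<in> rcosets\<^bsub>?K\<^esub> C"
        then obtain x where x: "x \<in> K" "U = C #>\<^bsub>?K\<^esub> x" by (auto simp: RCOSETS_def)
        then obtain i :: int and f where f: "f \<in> F" "x = c [^] i \<otimes> f" using F by blast
        have "x \<in> C #>\<^bsub>?K\<^esub> f" using f by (auto simp: r_coset_def C_def)
        then have "U = C #>\<^bsub>?K\<^esub> f"
          using K.repr_independence[of x C f] C x f F by auto
        then show "U \<in> (\<lambda>f. C #>\<^bsub>?K\<^esub> f) ` F" using f by blast
      qed
      then show ?thesis using F(1) finite_subset by blast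
    qed
    ultimately show "virtually_cyclic ?K" unfolding virtually_cyclic_def using C by blast
  qed
  then show ?thesis using True by (simp add: VC_def)
qed (simp add: VC_def)

lemma (in group) VC_E:
  assumes "K \<in> VC G"
  obtains c F where "c \<in> K" "finite F" "F \<subseteq> K" "K \<subseteq> {c [^] (i::int) \<otimes> f | i f. f \<in> F}"
  using assms[unfolded VC_iff] by (elim conjE bexE exE) (rule that)

lemma (in group) VC_I:
  assumes "subgroup K G" "c \<in> K" "finite F" "F \<subseteq> K" "K \<subseteq> {c [^] (i::int) \<otimes> f | i f. f \<in> F}"
  shows "K \<in> VC G"
  unfolding VC_iff using assms by (intro conjI bexI[of _ c] exI[of _ F])

lemma (in group) mult_inv_cancel_right:
  assumes "a \<in> carrier G" "b \<in> carrier G" "f \<in> carrier G"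
  shows "(a \<otimes> f) \<otimes> inv (b \<otimes> f) = a \<otimes> inv b"
proof -
  have "(a \<otimes> f) \<otimes> inv (b \<otimes> f) = a \<otimes> (f \<otimes> inv f) \<otimes> inv b"
    using assms by (simp only: inv_mult_group m_assoc inv_closed m_closed)
  then show ?thesis using assms by simp
qed

lemma (in group) VC_subset:
  assumes "K \<in> VC G" shows "subgroup K G" "K \<subseteq> carrier G"
  using assms subgroup.subset by (auto simp: VC_def)

lemma (in group) VC_power_in_cyclic:
  assumes c: "c \<in> carrier G" and F: "finite F" "F \<subseteq> carrier G"
    and K: "subgroup K G" "K \<subseteq> {c [^] (i::int) \<otimes> f | i f. f \<in> F}" and u: "u \<in> K"
  obtains e i :: int where "e > 0" "u [^] e = c [^] i"
proof -
  have uc: "u \<in> carrier G" using u subgroup.subset[OF K(1)] by blast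
  have "\<exists>f. f \<in> F \<and> (\<exists>i::int. u [^] int k = c [^] i \<otimes> f)" for k
    using subgroup_int_pow_closed[OF K(1) u, of "int k"] K(2) by blast
  then obtain f where f: "\<And>k. f k \<in> F \<and> (\<exists>i::int. u [^] int k = c [^] i \<otimes> f k)" by metis
  have "finite (range f)" using f F(1) by (auto intro: finite_subset)
  then have "\<not> inj f" using infinite_UNIV_nat finite_imageD by blast
  then obtain k l where kl: "k < l" "f k = f l" by (metis injI nat_neq_iff)
  obtain i j :: int where ij: "u [^] int k = c [^] i \<otimes> f l" "u [^] int l = c [^] j \<otimes> f l"
    using f[of k] f[of l] kl(2) by auto
  have fc: "f l \<in> carrier G" using f F by blast
  have "u [^] (int l - int k) = (c [^] j \<otimes> f l) \<otimes> inv (c [^] i \<otimes> f l)"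
    using uc ij by (simp add: int_pow_diff)
  also have "\<dots> = c [^] (j - i)" using c fc by (simp add: int_pow_diff mult_inv_cancel_right)
  finally show thesis using kl by (intro that[of "int l - int k" "j - i"]) auto
qed

lemma (in group) VC_dependent:
  assumes "K \<in> VC G" "u \<in> K" "v \<in> K"
  shows "\<exists>(m::int) (n::int). (m \<noteq> 0 \<or> n \<noteq> 0) \<and> u [^] m = v [^] n"
proof -
  have K: "subgroup K G" "K \<subseteq> carrier G" using VC_subset[OF assms(1)] by auto
  obtain c F where c: "c \<in> K" "finite F" "F \<subseteq> K" "K \<subseteq> {c [^] (i::int) \<otimes> f | i f. f \<in> F}"
    by (rule VC_E[OF assms(1)])
  have cc: "c \<in> carrier G" "F \<subseteq> carrier G" "u \<in> carrier G" "v \<in> carrier G" using c assms K by auto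
  obtain a p :: int where u: "a > 0" "u [^] a = c [^] p"
    by (rule VC_power_in_cyclic[OF cc(1) c(2) cc(2) K(1) c(4) assms(2)])
  obtain b q :: int where v: "b > 0" "v [^] b = c [^] q"
    by (rule VC_power_in_cyclic[OF cc(1) c(2) cc(2) K(1) c(4) assms(3)])
  show ?thesis
  proof (cases "p = 0")
    case True
    then have "u [^] a = v [^] (0::int)" using u by simp
    moreover have "a \<noteq> 0" using u(1) by simp
    ultimately show ?thesis by blast
  next
    case False
    have "u [^] (a * q) = (u [^] a) [^] q" using cc by (simp add: int_pow_pow)
    also have "\<dots> = (v [^] b) [^] p" unfolding u(2) v(2) using cc by (simp add: int_pow_pow mult.commute)
    also have "\<dots> = v [^] (b * p)" using cc by (simp add: int_pow_pow)
    finally have "u [^] (a * q) = v [^] (b * p)" .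
    moreover have "b * p \<noteq> 0" using False v by simp
    ultimately show ?thesis by blast
  qed
qed

text \<open>A dichotomy that separates the subgroups whose image modulo \<open>N\<close> is finite from those that meet
  \<open>N\<close> in a finite set: pass from \<open>c\<close> to its first power in \<open>N\<close>, if there is one.\<close>

lemma (in group) VC_adapted_generator:
  assumes K: "K \<in> VC G" and N: "subgroup N G"
  obtains c F where "c \<in> K" "finite F" "F \<subseteq> K" "K \<subseteq> {c [^] (i::int) \<otimes> f | i f. f \<in> F}"
    "c \<in> N \<or> (\<forall>i::int. i \<noteq> 0 \<longrightarrow> c [^] i \<notin> N)"
proof -
  have sub: "subgroup K G" "K \<subseteq> carrier G" using VC_subset[OF K] by auto
  obtain c F where c: "c \<in> K" "finite F" "F \<subseteq> K" "K \<subseteq> {c [^] (i::int) \<otimes> f | i f. f \<in> F}"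
    by (rule VC_E[OF K])
  have cc: "c \<in> carrier G" "F \<subseteq> carrier G" using c sub by auto
  show thesis
  proof (cases "\<exists>i::int. i \<noteq> 0 \<and> c [^] i \<in> N")
    case False
    then show ?thesis using that[OF c] by blast
  next
    case True
    then obtain i0 :: int where i0: "i0 \<noteq> 0" "c [^] i0 \<in> N" by blast
    define k where "k = \<bar>i0\<bar>"
    have k: "k > 0" using i0 by (simp add: k_def)
    have ckN: "c [^] k \<in> N" using subgroup_int_pow_dvd[OF N cc(1) i0(2)] by (simp add: k_def)
    define E where "E = (\<lambda>(i, f). c [^] i \<otimes> f) ` ({0..<k} \<times> F)"
    have "K \<subseteq> {(c [^] k) [^] (i::int) \<otimes> f | i f. f \<in> E}"
    proof
      fix x assume "x \<in> K"
      then obtain i :: int and f where f: "f \<in> F" "x = c [^] i \<otimes> f" using c by blast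
      have "c [^] i = c [^] (k * (i div k) + i mod k)" by simp
      also have "\<dots> = (c [^] k) [^] (i div k) \<otimes> c [^] (i mod k)"
        using cc by (simp only: int_pow_mult int_pow_pow)
      finally have "x = (c [^] k) [^] (i div k) \<otimes> (c [^] (i mod k) \<otimes> f)"
        using f cc by (auto simp: m_assoc)
      moreover have "c [^] (i mod k) \<otimes> f \<in> E"
        using f k by (auto simp: E_def intro!: image_eqI[of _ _ "(i mod k, f)"])
      ultimately show "x \<in> {(c [^] k) [^] (i::int) \<otimes> f | i f. f \<in> E}" by blast
    qed
    moreover have "E \<subseteq> K"
      using c subgroup.m_closed[OF sub(1)] subgroup_int_pow_closed[OF sub(1)] by (auto simp: E_def)
    moreover have "finite E" using c by (simp add: E_def)
    ultimately show ?thesis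
      using that[of "c [^] k" E] ckN subgroup_int_pow_closed[OF sub(1) c(1)] by blast
  qed
qed

text \<open>For each \<open>f\<close>, at most one of the elements \<open>c\<^sup>i f\<close> lies in \<open>X\<close>, because two of them differ by a
  nontrivial power of \<open>c\<close>, which is not in \<open>N\<close>.\<close>

lemma (in group) finite_powers_in_coset:
  assumes c: "c \<in> carrier G" and F: "finite F" "F \<subseteq> carrier G"
    and N: "subgroup N G" and free: "\<And>i::int. i \<noteq> 0 \<Longrightarrow> c [^] i \<notin> N"
    and X: "X \<subseteq> {c [^] (i::int) \<otimes> f | i f. f \<in> F}"
    and coset: "\<And>x y. x \<in> X \<Longrightarrow> y \<in> X \<Longrightarrow> x \<otimes> inv y \<in> N"
  shows "finite X \<and> card X \<le> card F"
proof -
  define h where "h f = (SOME x. x \<in> X \<and> (\<exists>i::int. x = c [^] i \<otimes> f))" for f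
  have "X \<subseteq> h ` F"
  proof
    fix x assume x: "x \<in> X"
    then obtain i :: int and f where f: "f \<in> F" "x = c [^] i \<otimes> f" using X by blast
    then have "\<exists>x. x \<in> X \<and> (\<exists>i::int. x = c [^] i \<otimes> f)" using x by blast
    then have "h f \<in> X \<and> (\<exists>i::int. h f = c [^] i \<otimes> f)"
      unfolding h_def by (rule someI_ex)
    then obtain j :: int where j: "h f \<in> X" "h f = c [^] j \<otimes> f" by blast
    have fc: "f \<in> carrier G" using f F by blast
    have "x \<otimes> inv (h f) = c [^] (i - j)"
      unfolding f(2) j(2) using c fc by (simp add: int_pow_diff mult_inv_cancel_right)
    then have "c [^] (i - j) \<in> N" using coset[OF x j(1)] by simp
    then have "i = j" using free[of "i - j"] by auto
    then have "x = h f" using f j by simp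
    then show "x \<in> h ` F" using f(1) by blast
  qed
  then show ?thesis using F(1) by (meson card_image_le card_mono finite_imageI finite_subset le_trans)
qed

lemma (in group) VC_Int:
  assumes K: "K \<in> VC G" and N: "subgroup N G"
  shows "K \<inter> N \<in> VC G"
proof -
  have sub: "subgroup K G" "K \<subseteq> carrier G" using VC_subset[OF K] by auto
  have KN: "subgroup (K \<inter> N) G" using subgroups_Inter_pair[OF sub(1) N] .
  obtain c F where c: "c \<in> K" "finite F" "F \<subseteq> K" "K \<subseteq> {c [^] (i::int) \<otimes> f | i f. f \<in> F}"
    and cN: "c \<in> N \<or> (\<forall>i::int. i \<noteq> 0 \<longrightarrow> c [^] i \<notin> N)"
    by (rule VC_adapted_generator[OF assms])
  have cc: "c \<in> carrier G" "F \<subseteq> carrier G" using c sub by auto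
  show ?thesis
  proof (cases "c \<in> N")
    case True
    have "K \<inter> N \<subseteq> {c [^] (i::int) \<otimes> f | i f. f \<in> F \<inter> N}"
    proof
      fix x assume x: "x \<in> K \<inter> N"
      then obtain i :: int and f where f: "f \<in> F" "x = c [^] i \<otimes> f" using c by blast
      have "f = inv (c [^] i) \<otimes> x" using f cc by (auto simp: m_assoc[symmetric])
      also have "\<dots> \<in> N"
        using x subgroup_int_pow_closed[OF N True] N by (auto intro: subgroup.m_closed subgroup.m_inv_closed)
      finally show "x \<in> {c [^] (i::int) \<otimes> f | i f. f \<in> F \<inter> N}" using f by blast
    qed
    then show ?thesis using KN True c by (intro VC_I[of _ c "F \<inter> N"]) auto
  next
    case False
    have "finite (K \<inter> N)"
      using finite_powers_in_coset[OF cc(1) c(2) cc(2) N, of "K \<inter> N"] False cN c(4) N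
      by (auto simp: subgroup.m_closed subgroup.m_inv_closed)
    moreover have "K \<inter> N \<subseteq> {\<one> [^] (i::int) \<otimes> f | i f. f \<in> K \<inter> N}"
    proof
      fix x assume x: "x \<in> K \<inter> N"
      then have "x = \<one> [^] (0::int) \<otimes> x" using sub by auto
      then show "x \<in> {\<one> [^] (i::int) \<otimes> f | i f. f \<in> K \<inter> N}" using x by blast
    qed
    ultimately show ?thesis
      using KN subgroup.one_closed[OF KN] by (intro VC_I[of _ \<one> "K \<inter> N"]) auto
  qed
qed

lemma (in group) VC_conjugate:
  assumes K: "K \<in> VC G" and r: "r \<in> carrier G"
  shows "(\<lambda>x. r \<otimes> x \<otimes> inv r) ` K \<in> VC G"
proof -
  have sub: "subgroup K G" "K \<subseteq> carrier G" using VC_subset[OF K] by auto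
  let ?h = "\<lambda>x. r \<otimes> x \<otimes> inv r"
  have "?h \<in> hom G G"
  proof (rule homI)
    fix x y assume xy: "x \<in> carrier G" "y \<in> carrier G"
    have "?h x \<otimes> ?h y = r \<otimes> x \<otimes> (inv r \<otimes> r) \<otimes> y \<otimes> inv r"
      using r xy by (simp only: m_assoc inv_closed m_closed)
    then show "?h (x \<otimes> y) = ?h x \<otimes> ?h y" using r xy by (simp add: m_assoc)
  qed (use r in auto)
  then interpret h: group_hom G G ?h by (simp add: group_hom_def group_hom_axioms_def is_group)
  obtain c F where c: "c \<in> K" "finite F" "F \<subseteq> K" "K \<subseteq> {c [^] (i::int) \<otimes> f | i f. f \<in> F}"
    by (rule VC_E[OF K])
  have "?h ` K \<subseteq> {?h c [^] (i::int) \<otimes> f | i f. f \<in> ?h ` F}"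
  proof
    fix y assume "y \<in> ?h ` K"
    then obtain x where x: "x \<in> K" "y = ?h x" by blast
    then obtain i :: int and f where f: "f \<in> F" "x = c [^] i \<otimes> f" using c by blast
    have cf: "c \<in> carrier G" "f \<in> carrier G" using f c sub by auto
    have "y = ?h (c [^] i) \<otimes> ?h f" unfolding x(2) f(2) using cf by (intro h.hom_mult) auto
    also have "?h (c [^] i) = ?h c [^] i" using cf by (intro h.hom_int_pow)
    finally show "y \<in> {?h c [^] (i::int) \<otimes> f | i f. f \<in> ?h ` F}" using f by blast
  qed
  then show ?thesis
    using h.subgroup_img_is_subgroup[OF sub(1)] c by (intro VC_I[of _ "?h c" "?h ` F"]) auto
qed

section \<open>Coverings by cosets and abelian images\<close>

text \<open>B. H. Neumann's covering lemma. If the cosets of \<open>H\<close> in the covering leave out some \<open>y\<close>, then the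
  coset \<open>Hy\<close> is disjoint from them and so is covered by cosets of the other subgroups. Then the same
  is true of every coset of \<open>H\<close>, and \<open>H\<close> can be removed from the list.\<close>

lemma (in group) coset_cover_finite_index:
  assumes "finite \<H>" "finite X" "X \<subseteq> carrier G" "\<And>H. H \<in> \<H> \<Longrightarrow> subgroup H G"
    and "carrier G \<subseteq> (\<Union>H\<in>\<H>. \<Union>x\<in>X. H #> x)"
  shows "\<exists>H\<in>\<H>. \<exists>Y. finite Y \<and> Y \<subseteq> carrier G \<and> carrier G \<subseteq> (\<Union>y\<in>Y. H #> y)"
  using assms
proof (induction \<H> arbitrary: X)
  case empty
  then show ?case using one_closed by auto
next
  case (insert H \<H>)
  have H: "subgroup H G" "H \<subseteq> carrier G" using insert.prems(3) subgroup.subset by auto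
  show ?case
  proof (cases "carrier G \<subseteq> (\<Union>x\<in>X. H #> x)")
    case True
    then show ?thesis using insert.prems by blast
  next
    case False
    then obtain y where y: "y \<in> carrier G" "\<And>x. x \<in> X \<Longrightarrow> y \<notin> H #> x" by blast
    define Z where "Z = X \<union> (\<lambda>(x, z). x \<otimes> (inv y \<otimes> z)) ` (X \<times> X)"
    have Z: "finite Z" "Z \<subseteq> carrier G" using insert.prems y by (auto simp: Z_def)
    have "g \<in> (\<Union>H\<in>\<H>. \<Union>x\<in>Z. H #> x)" if g: "g \<in> carrier G" for g
    proof -
      obtain H' x where Hx: "H' \<in> insert H \<H>" "x \<in> X" "g \<in> H' #> x" using insert.prems(4) g by blast
      show ?thesis
      proof (cases "H' = H")
        case False
        then show ?thesis using Hx by (auto simp: Z_def)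
      next
        case True
        then obtain h where h: "h \<in> H" "g = h \<otimes> x" using Hx by (auto simp: r_coset_def)
        have car: "h \<in> carrier G" "x \<in> carrier G" using h Hx insert.prems H by auto
        have "h \<otimes> y \<in> carrier G" using y car by simp
        then obtain H'' z where Hz: "H'' \<in> insert H \<H>" "z \<in> X" "h \<otimes> y \<in> H'' #> z"
          using insert.prems(4) by blast
        have zc: "z \<in> carrier G" using Hz insert.prems by auto
        have "H'' \<noteq> H"
        proof
          assume "H'' = H"
          then obtain h' where h': "h' \<in> H" "h \<otimes> y = h' \<otimes> z" using Hz by (auto simp: r_coset_def)
          then have "y = inv h \<otimes> (h' \<otimes> z)" using car y(1) zc H by (metis inv_solve_left m_closed subsetD)
          also have "\<dots> = (inv h \<otimes> h') \<otimes> z" using car h' zc H by (auto simp: m_assoc)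
          finally have "y \<in> H #> z" using h h' H(1)
            by (auto simp: r_coset_def subgroup.m_closed subgroup.m_inv_closed)
          then show False using y(2)[OF Hz(2)] by simp
        qed
        then have H'': "H'' \<in> \<H>" using Hz by simp
        obtain k where k: "k \<in> H''" "h \<otimes> y = k \<otimes> z" using Hz by (auto simp: r_coset_def)
        have kc: "k \<in> carrier G" using k H'' insert.prems(3)[of H''] subgroup.subset by blast
        have "g = (h \<otimes> y) \<otimes> (inv y \<otimes> x)"
          using h car y(1) by (simp add: m_assoc) (simp add: m_assoc[symmetric])
        also have "\<dots> = k \<otimes> (z \<otimes> (inv y \<otimes> x))" unfolding k(2) using kc zc car y(1) by (simp add: m_assoc)
        finally have "g \<in> H'' #> (z \<otimes> (inv y \<otimes> x))" using k by (auto simp: r_coset_def)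
        moreover have "z \<otimes> (inv y \<otimes> x) \<in> Z" using Hz Hx by (auto simp: Z_def)
        ultimately show ?thesis using H'' by blast
      qed
    qed
    then have "carrier G \<subseteq> (\<Union>H\<in>\<H>. \<Union>x\<in>Z. H #> x)" by (rule subsetI)
    then have "\<exists>H\<in>\<H>. \<exists>Y. finite Y \<and> Y \<subseteq> carrier G \<and> carrier G \<subseteq> (\<Union>y\<in>Y. H #> y)"
      using insert.prems(3) by (intro insert.IH[OF Z]) auto
    then show ?thesis by blast
  qed
qed

text \<open>The image of \<open>g\<close> in a commutative group depends only on the conjugacy class of \<open>g\<close>, so the covering
  by conjugates becomes a covering of \<open>G\<close> by finitely many cosets of the preimages of the cyclic
  groups \<open>\<langle>h c\<rangle>\<close>, to which Neumann's lemma applies.\<close>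

lemma (in group_hom) abelian_image_cyclic_cover:
  assumes comm: "comm_group H" and fin: "finite \<K>" and VC: "\<K> \<subseteq> VC G"
    and cover: "\<And>g. g \<in> carrier G \<Longrightarrow> \<exists>a\<in>carrier G. \<exists>K\<in>\<K>. a \<otimes> g \<otimes> inv a \<in> K"
  obtains c F where "c \<in> carrier G" "finite F" "F \<subseteq> carrier G"
    "\<And>g. g \<in> carrier G \<Longrightarrow> \<exists>(i::int). \<exists>f\<in>F. h g = h (c [^] i \<otimes> f)"
proof -
  interpret H: comm_group H by (rule comm)
  define P where "P K c F \<longleftrightarrow> c \<in> K \<and> finite F \<and> F \<subseteq> K \<and> K \<subseteq> {c [^] (i::int) \<otimes> f | i f. f \<in> F}" for K c F
  have "\<exists>c F. P K c F" if "K \<in> \<K>" for K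
    unfolding P_def by (rule G.VC_E[OF subsetD[OF VC that]]) blast
  then obtain c F where cF: "\<And>K. K \<in> \<K> \<Longrightarrow> P K (c K) (F K)" by metis
  have sub: "K \<subseteq> carrier G" if "K \<in> \<K>" for K using that VC G.VC_subset(2) by blast
  have cc: "c K \<in> carrier G" and F: "finite (F K)" "F K \<subseteq> carrier G"
    and K: "K \<subseteq> {c K [^] (i::int) \<otimes> f | i f. f \<in> F K}" if "K \<in> \<K>" for K
    using cF[OF that] sub[OF that] unfolding P_def by blast+
  define U where "U K = {x \<in> carrier G. \<exists>i::int. h x = h (c K) [^]\<^bsub>H\<^esub> i}" for K
  have U: "subgroup (U K) G" if "K \<in> \<K>" for K
  proof (rule G.subgroupI)
    show "U K \<subseteq> carrier G" by (auto simp: U_def)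
    have "h \<one> = h (c K) [^]\<^bsub>H\<^esub> (0::int)" by simp
    then show "U K \<noteq> {}" unfolding U_def by blast
    show "inv x \<in> U K" if "x \<in> U K" for x
    proof -
      obtain i :: int where x: "x \<in> carrier G" "h x = h (c K) [^]\<^bsub>H\<^esub> i" using \<open>x \<in> U K\<close> by (auto simp: U_def)
      then have "h (inv x) = h (c K) [^]\<^bsub>H\<^esub> (-i)" using cc[OF \<open>K \<in> \<K>\<close>] by (simp add: H.int_pow_neg)
      then show ?thesis using x unfolding U_def by blast
    qed
    show "x \<otimes> y \<in> U K" if "x \<in> U K" "y \<in> U K" for x y
    proof -
      obtain i j :: int where x: "x \<in> carrier G" "h x = h (c K) [^]\<^bsub>H\<^esub> i"
        and y: "y \<in> carrier G" "h y = h (c K) [^]\<^bsub>H\<^esub> j" using \<open>x \<in> U K\<close> \<open>y \<in> U K\<close> by (auto simp: U_def)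
      then have "h (x \<otimes> y) = h (c K) [^]\<^bsub>H\<^esub> (i + j)" using cc[OF \<open>K \<in> \<K>\<close>] by (simp add: H.int_pow_mult)
      then show ?thesis using x y unfolding U_def by blast
    qed
  qed
  define X where "X = (\<Union>K\<in>\<K>. F K)"
  have X: "finite X" "X \<subseteq> carrier G" using F fin by (auto simp: X_def)
  have "g \<in> (\<Union>V\<in>U ` \<K>. \<Union>x\<in>X. V #> x)" if g: "g \<in> carrier G" for g
  proof -
    obtain a K where a: "a \<in> carrier G" "K \<in> \<K>" "a \<otimes> g \<otimes> inv a \<in> K" using cover[OF g] by blast
    then obtain i :: int and f where f: "f \<in> F K" "a \<otimes> g \<otimes> inv a = c K [^] i \<otimes> f" using K by blast
    have fc: "f \<in> carrier G" using f F[OF a(2)] by blast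
    have "h (a \<otimes> g \<otimes> inv a) = h g"
      using a(1) g by (simp add: H.m_comm[of "h a"] H.m_assoc)
    then have hg: "h g = h (c K) [^]\<^bsub>H\<^esub> i \<otimes>\<^bsub>H\<^esub> h f"
      using f(2) cc[OF a(2)] fc by (simp add: hom_int_pow)
    have "h (g \<otimes> inv f) = h (c K) [^]\<^bsub>H\<^esub> i"
      using g fc cc[OF a(2)] hg by (simp add: H.m_assoc)
    then have "g \<otimes> inv f \<in> U K" using g fc unfolding U_def by blast
    moreover have "g = (g \<otimes> inv f) \<otimes> f" using g fc by (simp add: G.m_assoc)
    ultimately have "g \<in> U K #> f" unfolding r_coset_def by blast
    then show ?thesis using a(2) f(1) by (auto simp: X_def)
  qed
  then have "\<exists>V\<in>U ` \<K>. \<exists>Y. finite Y \<and> Y \<subseteq> carrier G \<and> carrier G \<subseteq> (\<Union>y\<in>Y. V #> y)"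
    using U fin X by (intro G.coset_cover_finite_index[of _ X]) auto
  then obtain K Y where KY: "K \<in> \<K>" "finite Y" "Y \<subseteq> carrier G" "carrier G \<subseteq> (\<Union>y\<in>Y. U K #> y)" by blast
  have "\<exists>(i::int). \<exists>f\<in>Y. h g = h (c K [^] i \<otimes> f)" if g: "g \<in> carrier G" for g
  proof -
    obtain y u where y: "y \<in> Y" "u \<in> U K" "g = u \<otimes> y"
      using KY(4) g unfolding r_coset_def by blast
    then obtain i :: int where "u \<in> carrier G" "h u = h (c K) [^]\<^bsub>H\<^esub> i" unfolding U_def by blast
    moreover have "y \<in> carrier G" using y KY by blast
    ultimately have "h g = h (c K [^] i \<otimes> y)" using y(3) cc[OF KY(1)] by (simp add: hom_int_pow)
    then show ?thesis using y by blast
  qed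
  then show thesis by (rule that[OF cc[OF KY(1)] KY(2,3)])
qed

section \<open>An abelian section on which an element acts\<close>

lemma (in normal) r_coset_group_hom: "group_hom G (G Mod H) (\<lambda>x. H #> x)"
  by (simp add: group_hom_def group_hom_axioms_def is_group factorgroup_is_group r_coset_hom_Mod)

lemma (in normal) r_coset_eq_self_iff:
  assumes "x \<in> carrier G" shows "H #> x = H \<longleftrightarrow> x \<in> H"
  using assms coset_join1 coset_join2 is_subgroup subset by blast

lemma (in normal) r_coset_eq_iff:
  assumes "x \<in> carrier G" "y \<in> carrier G" shows "H #> x = H #> y \<longleftrightarrow> x \<otimes> inv y \<in> H"
proof
  show "x \<otimes> inv y \<in> H" if "H #> x = H #> y"
    using that rcos_self[OF assms(1) is_subgroup] rcos_module_imp[OF is_group assms(2)] by simp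
  show "H #> x = H #> y" if "x \<otimes> inv y \<in> H"
    using rcos_module_rev[OF is_group assms(2,1) that] repr_independence[OF _ assms(2) is_subgroup] by simp
qed

text \<open>The uniformity in \<open>n\<close> is the point. If a power of the cyclic part lies in \<open>N\<close>, then every element
  of \<open>K\<close> has finite order modulo \<open>N\<close> and \<open>K\<close> misses all cosets \<open>N t\<^sup>n\<close>. Otherwise each of the
  finitely many sets \<open>\<langle>c\<rangle> f\<close> contributes at most one element.\<close>

lemma (in group) VC_few_in_cosets:
  assumes K: "K \<in> VC G" and N: "N \<lhd> G" and t: "t \<in> carrier G"
    and free: "\<And>i::int. i \<noteq> 0 \<Longrightarrow> t [^] i \<notin> N"
  shows "\<exists>C. \<forall>n::int. n > 0 \<longrightarrow> finite {k \<in> K. k \<otimes> inv (t [^] n) \<in> N} \<and>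
    card {k \<in> K. k \<otimes> inv (t [^] n) \<in> N} \<le> C"
proof -
  interpret N: normal N G by (rule N)
  interpret \<pi>: group_hom G "G Mod N" "\<lambda>x. N #> x" by (rule N.r_coset_group_hom)
  have sub: "subgroup K G" "K \<subseteq> carrier G" using VC_subset[OF K] by auto
  obtain c F where c: "c \<in> K" "finite F" "F \<subseteq> K" "K \<subseteq> {c [^] (i::int) \<otimes> f | i f. f \<in> F}"
    and cN: "c \<in> N \<or> (\<forall>i::int. i \<noteq> 0 \<longrightarrow> c [^] i \<notin> N)"
    by (rule VC_adapted_generator[OF K N.is_subgroup])
  have cc: "c \<in> carrier G" "F \<subseteq> carrier G" using c sub by auto
  have "finite {k \<in> K. k \<otimes> inv (t [^] n) \<in> N} \<and> card {k \<in> K. k \<otimes> inv (t [^] n) \<in> N} \<le> card F"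
    if n: "n > 0" for n :: int
  proof (cases "c \<in> N")
    case True
    have "{k \<in> K. k \<otimes> inv (t [^] n) \<in> N} = {}"
    proof (rule ccontr)
      assume "{k \<in> K. k \<otimes> inv (t [^] n) \<in> N} \<noteq> {}"
      then obtain k where k: "k \<in> K" "k \<otimes> inv (t [^] n) \<in> N" by blast
      have kc: "k \<in> carrier G" using k sub by blast
      obtain e i :: int where e: "e > 0" "k [^] e = c [^] i"
        by (rule VC_power_in_cyclic[OF cc(1) c(2) cc(2) sub(1) c(4) k(1)])
      have "k [^] e \<in> N" unfolding e using subgroup_int_pow_closed[OF N.is_subgroup True] .
      have "N #> k = N #> (t [^] n)" using k kc t by (simp add: N.r_coset_eq_iff)
      then have "(N #> k) [^]\<^bsub>G Mod N\<^esub> e = (N #> (t [^] n)) [^]\<^bsub>G Mod N\<^esub> e" by simp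
      then have "N #> (k [^] e) = N #> (t [^] (n * e))"
        using kc t \<pi>.hom_int_pow[of k e] \<pi>.hom_int_pow[of "t [^] n" e] by (simp add: int_pow_pow)
      moreover have "N #> (k [^] e) = N" using kc \<open>k [^] e \<in> N\<close> by (simp add: N.r_coset_eq_self_iff)
      ultimately have "t [^] (n * e) \<in> N" using t N.r_coset_eq_self_iff[of "t [^] (n * e)"] by simp
      then show False using free[of "n * e"] n e by simp
    qed
    then show ?thesis by (metis card.empty finite.emptyI le0)
  next
    case False
    show ?thesis
    proof (rule finite_powers_in_coset[OF cc(1) c(2) cc(2) N.is_subgroup])
      show "c [^] i \<notin> N" if "i \<noteq> 0" for i :: int using cN False that by blast
      show "{k \<in> K. k \<otimes> inv (t [^] n) \<in> N} \<subseteq> {c [^] (i::int) \<otimes> f | i f. f \<in> F}" using c by blast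
      fix x y assume xy: "x \<in> {k \<in> K. k \<otimes> inv (t [^] n) \<in> N}" "y \<in> {k \<in> K. k \<otimes> inv (t [^] n) \<in> N}"
      then have "x \<in> carrier G" "y \<in> carrier G" using sub by auto
      moreover from this have "N #> x = N #> (t [^] n)" "N #> y = N #> (t [^] n)"
        using xy t by (simp_all add: N.r_coset_eq_iff)
      ultimately have "x \<in> carrier G" "y \<in> carrier G" "N #> x = N #> y" by simp_all
      then show "x \<otimes> inv y \<in> N" using N.r_coset_eq_iff[of x y] by simp
    qed
  qed
  then show ?thesis by blast
qed

lemma (in comm_group) mult_inv_mult_cancel:
  assumes "b \<in> carrier G" "x \<in> carrier G" "y \<in> carrier G"
  shows "(b \<otimes> x \<otimes> inv y) \<otimes> (y \<otimes> inv b) = x"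
proof -
  have "(b \<otimes> x \<otimes> inv y) \<otimes> (y \<otimes> inv b) = (b \<otimes> inv b) \<otimes> (y \<otimes> inv y) \<otimes> x"
    using assms by (simp only: m_ac m_closed inv_closed)
  then show ?thesis using assms by simp
qed

text \<open>Translation of the covering of \<open>G\<close> by conjugates into the language of the module \<open>A\<close>. Conjugates
  of \<open>x \<in> N\<close> by \<open>t\<^sup>j m\<close> give the translate \<open>t\<^sup>j \<pi>(x)\<close>, since \<open>m\<close> acts trivially on \<open>A\<close>. The
  conjugate of \<open>x t\<^sup>n\<close> by the same element is \<open>w t\<^sup>n\<close> with
  \<open>\<pi>(w) = t\<^sup>j (\<pi>(x) + \<pi>(m) - t\<^sup>n \<pi>(m))\<close>, and by \<open>VC_few_in_cosets\<close> there are boundedly many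
  possible \<open>w\<close>.\<close>

lemma (in group) finite_abelian_section:
  assumes N: "N \<lhd> G" and t: "t \<in> carrier G" and free: "\<And>i::int. i \<noteq> 0 \<Longrightarrow> t [^] i \<notin> N"
    and A: "comm_group A" and \<pi>: "\<pi> \<in> hom (G\<lparr>carrier := N\<rparr>) A" "\<pi> ` N = carrier A"
    and T: "\<And>j x. x \<in> N \<Longrightarrow> T j (\<pi> x) = \<pi> (t [^] (j::int) \<otimes> x \<otimes> inv (t [^] j))"
    and fin: "finite \<K>" and VC: "\<K> \<subseteq> VC G"
    and cover: "\<And>g. g \<in> carrier G \<Longrightarrow>
      \<exists>j::int. \<exists>m\<in>N. \<exists>K\<in>\<K>. (t [^] j \<otimes> m) \<otimes> g \<otimes> inv (t [^] j \<otimes> m) \<in> K"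
  shows "finite (carrier A)"
proof -
  interpret N: normal N G by (rule N)
  have Nc [simp]: "x \<in> carrier G" if "x \<in> N" for x using that by (rule N.mem_carrier)
  interpret NG: group "G\<lparr>carrier := N\<rparr>" by (rule subgroup_imp_group[OF N.is_subgroup])
  interpret A: comm_group A by (rule A)
  interpret \<pi>: group_hom "G\<lparr>carrier := N\<rparr>" A \<pi>
    using \<pi>(1) by (simp add: group_hom_def group_hom_axioms_def NG.is_group A.is_group)
  have \<pi>c [simp]: "\<pi> x \<in> carrier A" if "x \<in> N" for x using \<pi>.hom_closed that by simp
  have \<pi>m: "\<pi> (x \<otimes> y) = \<pi> x \<otimes>\<^bsub>A\<^esub> \<pi> y" if "x \<in> N" "y \<in> N" for x y using \<pi>.hom_mult that by simp
  have \<pi>i: "\<pi> (inv x) = inv\<^bsub>A\<^esub> \<pi> x" if "x \<in> N" for x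
    using \<pi>.hom_inv[of x] that m_inv_consistent[OF N.is_subgroup that] by simp
  have \<pi>p: "\<pi> (x [^] (i::int)) = \<pi> x [^]\<^bsub>A\<^esub> i" if "x \<in> N" for x i
    using \<pi>.hom_int_pow[of x i] that int_pow_consistent[OF N.is_subgroup that, of i] by simp
  have surj: "\<exists>x\<in>N. a = \<pi> x" if "a \<in> carrier A" for a using that \<pi>(2) by blast
  have conjN: "r \<otimes> x \<otimes> inv r \<in> N" if "r \<in> carrier G" "x \<in> N" for r x
    using N.inv_op_closed2[OF that] .
  have tc [simp]: "t [^] (j::int) \<in> carrier G" for j using t by simp
  interpret integer_action A T
  proof (unfold_locales)
    fix j show "T j \<in> hom A A"
    proof (rule homI)
      fix a assume "a \<in> carrier A"
      then obtain x where "x \<in> N" "a = \<pi> x" using surj by blast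
      then show "T j a \<in> carrier A" using conjN by (simp add: T)
    next
      fix a b assume "a \<in> carrier A" "b \<in> carrier A"
      then obtain x y where xy: "x \<in> N" "a = \<pi> x" "y \<in> N" "b = \<pi> y" using surj by blast
      let ?r = "t [^] j"
      have "?r \<otimes> (x \<otimes> y) \<otimes> inv ?r = ?r \<otimes> x \<otimes> (inv ?r \<otimes> ?r) \<otimes> y \<otimes> inv ?r"
        using xy by (simp add: m_assoc)
      also have "\<dots> = (?r \<otimes> x \<otimes> inv ?r) \<otimes> (?r \<otimes> y \<otimes> inv ?r)"
        using xy by (simp only: m_assoc inv_closed m_closed Nc tc)
      finally have "T j (\<pi> (x \<otimes> y)) = \<pi> ((?r \<otimes> x \<otimes> inv ?r) \<otimes> (?r \<otimes> y \<otimes> inv ?r))"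
        using xy by (simp add: T N.m_closed)
      also have "\<dots> = T j a \<otimes>\<^bsub>A\<^esub> T j b"
        using xy conjN[OF tc] by (simp add: \<pi>m T)
      finally show "T j (a \<otimes>\<^bsub>A\<^esub> b) = T j a \<otimes>\<^bsub>A\<^esub> T j b" using xy by (simp add: \<pi>m)
    qed
  next
    fix a assume "a \<in> carrier A"
    then obtain x where x: "x \<in> N" "a = \<pi> x" using surj by blast
    then show "T 0 a = a" by (simp add: T)
    fix i j :: int
    have "t [^] i \<otimes> (t [^] j \<otimes> x \<otimes> inv (t [^] j)) \<otimes> inv (t [^] i)
        = (t [^] i \<otimes> t [^] j) \<otimes> x \<otimes> inv (t [^] i \<otimes> t [^] j)"
      using x by (simp add: m_assoc inv_mult_group)
    then show "T i (T j a) = T (i + j) a"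
      using x conjN[OF tc] t by (simp add: T int_pow_mult)
  qed
  obtain C where C: "\<And>K n. K \<in> \<K> \<Longrightarrow> (n::int) > 0 \<Longrightarrow>
    finite {k \<in> K. k \<otimes> inv (t [^] n) \<in> N} \<and> card {k \<in> K. k \<otimes> inv (t [^] n) \<in> N} \<le> C K"
  proof -
    have "\<forall>K. \<exists>C. K \<in> \<K> \<longrightarrow> (\<forall>n::int. n > 0 \<longrightarrow> finite {k \<in> K. k \<otimes> inv (t [^] n) \<in> N} \<and>
       card {k \<in> K. k \<otimes> inv (t [^] n) \<in> N} \<le> C)"
      using VC_few_in_cosets[OF _ N t free] VC by blast
    from choice[OF this] obtain C where "\<forall>K. K \<in> \<K> \<longrightarrow>
      (\<forall>n::int. n > 0 \<longrightarrow> finite {k \<in> K. k \<otimes> inv (t [^] n) \<in> N} \<and>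
       card {k \<in> K. k \<otimes> inv (t [^] n) \<in> N} \<le> C K)" ..
    then show thesis by (intro that) blast
  qed
  show ?thesis
  proof (rule finite_if_few_twisted_classes[of "(\<lambda>K. \<pi> ` (K \<inter> N)) ` \<K>" "\<Sum>K\<in>\<K>. C K"])
    show "finite ((\<lambda>K. \<pi> ` (K \<inter> N)) ` \<K>)" using fin by simp
    fix L assume "L \<in> (\<lambda>K. \<pi> ` (K \<inter> N)) ` \<K>"
    then obtain K where K: "K \<in> \<K>" "L = \<pi> ` (K \<inter> N)" by blast
    show "L \<subseteq> carrier A" using K by auto
    have KN: "K \<inter> N \<in> VC G" using VC_Int[OF _ N.is_subgroup] K VC by blast
    obtain c F where c: "c \<in> K \<inter> N" "finite F" "F \<subseteq> K \<inter> N"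
      "K \<inter> N \<subseteq> {c [^] (i::int) \<otimes> f | i f. f \<in> F}" by (rule VC_E[OF KN])
    show "\<exists>S\<subseteq>L. finite S \<and> L \<subseteq> generate A S"
    proof (intro exI[of _ "\<pi> ` insert c F"] conjI)
      show "\<pi> ` insert c F \<subseteq> L" using c K by blast
      show "finite (\<pi> ` insert c F)" using c by simp
      have sub: "subgroup (generate A (\<pi> ` insert c F)) A"
        using c by (intro A.generate_is_subgroup) auto
      show "L \<subseteq> generate A (\<pi> ` insert c F)"
      proof
        fix l assume "l \<in> L"
        then obtain i :: int and f where f: "f \<in> F" "l = \<pi> (c [^] i \<otimes> f)" using K c by blast
        have "l = \<pi> c [^]\<^bsub>A\<^esub> i \<otimes>\<^bsub>A\<^esub> \<pi> f"
          using f c subgroup_int_pow_closed[OF N.is_subgroup, of c i] by (auto simp: \<pi>m \<pi>p)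
        moreover have "\<pi> c [^]\<^bsub>A\<^esub> i \<in> generate A (\<pi> ` insert c F)"
          by (intro A.subgroup_int_pow_closed[OF sub] generate.incl) simp
        moreover have "\<pi> f \<in> generate A (\<pi> ` insert c F)"
          using f by (intro generate.incl) simp
        ultimately show "l \<in> generate A (\<pi> ` insert c F)"
          by (simp only: generate.eng)
      qed
    qed
    fix u v assume "u \<in> L" "v \<in> L"
    then obtain x y where xy: "x \<in> K" "x \<in> N" "u = \<pi> x" "y \<in> K" "y \<in> N" "v = \<pi> y" using K by blast
    obtain m n :: int where mn: "m \<noteq> 0 \<or> n \<noteq> 0" "x [^] m = y [^] n"
      using VC_dependent[of K x y] xy K VC by blast
    then have "\<pi> x [^]\<^bsub>A\<^esub> m = \<pi> y [^]\<^bsub>A\<^esub> n" using xy \<pi>p by metis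
    then show "\<exists>(m::int) (n::int). (m \<noteq> 0 \<or> n \<noteq> 0) \<and> u [^]\<^bsub>A\<^esub> m = v [^]\<^bsub>A\<^esub> n"
      using mn(1) xy by blast
  next
    fix a assume "a \<in> carrier A"
    then obtain x where x: "x \<in> N" "a = \<pi> x" using surj by blast
    obtain j m K where jm: "m \<in> N" "K \<in> \<K>" "(t [^] (j::int) \<otimes> m) \<otimes> x \<otimes> inv (t [^] j \<otimes> m) \<in> K"
      using cover[OF Nc[OF x(1)]] by blast
    have "(t [^] j \<otimes> m) \<otimes> x \<otimes> inv (t [^] j \<otimes> m) = t [^] j \<otimes> (m \<otimes> x \<otimes> inv m) \<otimes> inv (t [^] j)"
      using jm x by (simp add: m_assoc inv_mult_group)
    then have "T j (\<pi> (m \<otimes> x \<otimes> inv m)) \<in> \<pi> ` (K \<inter> N)"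
      using jm x conjN[OF tc] conjN[of m x] by (auto simp: T)
    moreover have "\<pi> (m \<otimes> x \<otimes> inv m) = a"
      using jm x by (simp add: \<pi>m \<pi>i A.m_comm[of "\<pi> m"] A.m_assoc)
    ultimately show "\<exists>j. \<exists>L\<in>(\<lambda>K. \<pi> ` (K \<inter> N)) ` \<K>. T j a \<in> L" using jm(2) by auto
  next
    fix n :: int assume n: "n > 0"
    define B where "B = (\<Union>K\<in>\<K>. (\<lambda>k. \<pi> (k \<otimes> inv (t [^] n))) ` {k \<in> K. k \<otimes> inv (t [^] n) \<in> N})"
    have "finite B" using C n fin by (auto simp: B_def)
    moreover have "B \<subseteq> carrier A" by (auto simp: B_def)
    moreover have "card B \<le> (\<Sum>K\<in>\<K>. C K)"
    proof -
      have "card B \<le> (\<Sum>K\<in>\<K>. card ((\<lambda>k. \<pi> (k \<otimes> inv (t [^] n))) ` {k \<in> K. k \<otimes> inv (t [^] n) \<in> N}))"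
        unfolding B_def using fin by (rule card_UN_le)
      also have "\<dots> \<le> (\<Sum>K\<in>\<K>. C K)"
        using C n by (intro sum_mono) (meson card_image_le le_trans)
      finally show ?thesis .
    qed
    moreover have "\<exists>j. \<exists>b\<in>carrier A. \<exists>\<beta>\<in>B. T j a = \<beta> \<otimes>\<^bsub>A\<^esub> (T n b \<otimes>\<^bsub>A\<^esub> inv\<^bsub>A\<^esub> b)"
      if a: "a \<in> carrier A" for a
    proof -
      obtain x where x: "x \<in> N" "a = \<pi> x" using surj[OF a] by blast
      let ?g = "x \<otimes> t [^] n"
      obtain j m K where jm: "m \<in> N" "K \<in> \<K>" "(t [^] (j::int) \<otimes> m) \<otimes> ?g \<otimes> inv (t [^] j \<otimes> m) \<in> K"
        using cover[of ?g] x by auto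
      let ?k = "(t [^] j \<otimes> m) \<otimes> ?g \<otimes> inv (t [^] j \<otimes> m)"
      let ?w = "m \<otimes> x \<otimes> (t [^] n \<otimes> inv m \<otimes> inv (t [^] n))"
      have uN: "t [^] n \<otimes> inv m \<otimes> inv (t [^] n) \<in> N" using jm conjN[OF tc, of "inv m" n] by simp
      have wN: "?w \<in> N" using N.m_closed[OF N.m_closed[OF jm(1) x(1)] uN] .
      have comm: "inv (t [^] j) \<otimes> inv (t [^] n) = inv (t [^] n) \<otimes> inv (t [^] j)"
        using t by (simp add: inv_mult_group[symmetric] int_pow_mult[symmetric] add.commute)
      have "?k \<otimes> inv (t [^] n) = t [^] j \<otimes> (m \<otimes> x \<otimes> (t [^] n \<otimes> inv m)) \<otimes> (inv (t [^] j) \<otimes> inv (t [^] n))"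
        using jm x by (simp add: m_assoc inv_mult_group)
      also have "\<dots> = t [^] j \<otimes> ?w \<otimes> inv (t [^] j)"
        unfolding comm using jm x by (simp add: m_assoc)
      finally have k: "?k \<otimes> inv (t [^] n) = t [^] j \<otimes> ?w \<otimes> inv (t [^] j)" .
      define \<beta> where "\<beta> = T j (\<pi> ?w)"
      have "?k \<otimes> inv (t [^] n) \<in> N" unfolding k using conjN[OF tc wN] .
      moreover have "\<beta> = \<pi> (?k \<otimes> inv (t [^] n))" unfolding k \<beta>_def by (rule T[OF wN])
      ultimately have \<beta>: "\<beta> \<in> B" using jm by (auto simp: B_def)
      define b where "b = T j (\<pi> m)"
      have b: "b \<in> carrier A" using jm by (simp add: b_def)
      have "\<pi> (t [^] n \<otimes> inv m \<otimes> inv (t [^] n)) = inv\<^bsub>A\<^esub> T n (\<pi> m)"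
        using T[of "inv m" n] jm T_inv[of "\<pi> m" n] by (simp add: \<pi>i)
      then have "\<pi> ?w = \<pi> m \<otimes>\<^bsub>A\<^esub> a \<otimes>\<^bsub>A\<^esub> inv\<^bsub>A\<^esub> T n (\<pi> m)"
        using jm x uN N.m_closed[OF jm(1) x(1)] by (simp only: \<pi>m)
      then have "\<beta> = b \<otimes>\<^bsub>A\<^esub> T j a \<otimes>\<^bsub>A\<^esub> inv\<^bsub>A\<^esub> T n b"
        using jm \<open>a \<in> carrier A\<close> by (simp add: \<beta>_def b_def T_mult T_inv T_T add.commute)
      then have "\<beta> \<otimes>\<^bsub>A\<^esub> (T n b \<otimes>\<^bsub>A\<^esub> inv\<^bsub>A\<^esub> b) = T j a"
        using b \<open>a \<in> carrier A\<close> by (simp add: A.mult_inv_mult_cancel)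
      then show ?thesis using \<beta> b by metis
    qed
    ultimately show "\<exists>B. finite B \<and> B \<subseteq> carrier A \<and> card B \<le> (\<Sum>K\<in>\<K>. C K) \<and>
      (\<forall>a\<in>carrier A. \<exists>j. \<exists>b\<in>carrier A. \<exists>\<beta>\<in>B. T j a = \<beta> \<otimes>\<^bsub>A\<^esub> (T n b \<otimes>\<^bsub>A\<^esub> inv\<^bsub>A\<^esub> b))"
      by blast
  qed
qed

section \<open>Groups of class two\<close>

text \<open>Commutators are bilinear because they are central. If \<open>x\<^sup>e\<close> and \<open>y\<^sup>e\<^sup>'\<close> are powers of \<open>c\<close> modulo
  the derived group, then \<open>[x, y]\<^sup>e\<^sup>e\<^sup>' = [x\<^sup>e, y\<^sup>e\<^sup>'] = 1\<close>; and the commutators of the elements of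
  \<open>{c} \<union> F\<close> generate the derived group, since \<open>c\<close> and \<open>F\<close> generate everything modulo it.\<close>

lemma (in group) finite_derived_of_central:
  defines "D \<equiv> derived G (carrier G)"
  assumes central: "\<And>z x. z \<in> D \<Longrightarrow> x \<in> carrier G \<Longrightarrow> z \<otimes> x = x \<otimes> z"
    and c: "c \<in> carrier G" and F: "finite F" "F \<subseteq> carrier G"
    and cover: "\<And>g. g \<in> carrier G \<Longrightarrow> \<exists>(i::int). \<exists>f\<in>F. D #> g = D #> (c [^] i \<otimes> f)"
  shows "finite D"
proof -
  interpret D: normal D G unfolding D_def by (rule derived_self_is_normal)
  interpret \<pi>: group_hom G "G Mod D" "\<lambda>x. D #> x" by (rule D.r_coset_group_hom)
  have Dc: "z \<in> carrier G" if "z \<in> D" for z using that by (rule D.mem_carrier)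
  define q where "q x y = x \<otimes> y \<otimes> inv x \<otimes> inv y" for x y
  have qc [simp]: "q x y \<in> carrier G" if "x \<in> carrier G" "y \<in> carrier G" for x y
    using that by (simp add: q_def)
  have qD: "q x y \<in> D" if "x \<in> carrier G" "y \<in> carrier G" for x y
    using that unfolding D_def derived_def q_def by (intro generate.incl) blast
  have q_left: "q (x1 \<otimes> x2) y = q x1 y \<otimes> q x2 y"
    if xy: "x1 \<in> carrier G" "x2 \<in> carrier G" "y \<in> carrier G" for x1 x2 y
  proof -
    let ?w = "q x2 y"
    have "?w \<otimes> y = x2 \<otimes> y \<otimes> inv x2" using xy by (simp add: q_def m_assoc)
    then have "q (x1 \<otimes> x2) y = x1 \<otimes> (?w \<otimes> y) \<otimes> inv x1 \<otimes> inv y"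
      using xy by (simp add: q_def inv_mult_group m_assoc)
    also have "\<dots> = (x1 \<otimes> ?w) \<otimes> y \<otimes> inv x1 \<otimes> inv y" using xy by (simp add: m_assoc)
    also have "\<dots> = (?w \<otimes> x1) \<otimes> y \<otimes> inv x1 \<otimes> inv y" using central[OF qD] xy by simp
    also have "\<dots> = ?w \<otimes> q x1 y" using xy by (simp add: q_def m_assoc)
    also have "\<dots> = q x1 y \<otimes> ?w" using xy by (intro central qD) auto
    finally show ?thesis .
  qed
  have q_inv: "q x y = inv (q y x)" if "x \<in> carrier G" "y \<in> carrier G" for x y
    using that by (simp add: q_def inv_mult_group m_assoc)
  have q_right: "q x (y1 \<otimes> y2) = q x y1 \<otimes> q x y2"
    if xy: "x \<in> carrier G" "y1 \<in> carrier G" "y2 \<in> carrier G" for x y1 y2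
  proof -
    have "q x (y1 \<otimes> y2) = inv (q y1 x \<otimes> q y2 x)" using xy q_left by (simp add: q_inv[of x])
    also have "\<dots> = q x y2 \<otimes> q x y1" using xy by (simp add: inv_mult_group q_inv[of x])
    also have "\<dots> = q x y1 \<otimes> q x y2" using xy by (intro central qD) auto
    finally show ?thesis .
  qed
  have q_pow_left: "q (x [^] i) y = q x y [^] i" if "x \<in> carrier G" "y \<in> carrier G" for x y and i :: int
  proof -
    have "(\<lambda>x. q x y) \<in> hom G G" using that q_left by (intro homI) auto
    then show ?thesis using hom_int_pow[of "\<lambda>x. q x y" G G x i] that is_group by simp
  qed
  have q_pow_right: "q x (y [^] i) = q x y [^] i" if "x \<in> carrier G" "y \<in> carrier G" for x y and i :: int
  proof -
    have "(\<lambda>y. q x y) \<in> hom G G" using that q_right by (intro homI) auto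
    then show ?thesis using hom_int_pow[of "\<lambda>y. q x y" G G y i] that is_group by simp
  qed
  have q_comm: "q x y = \<one>" if "x \<in> carrier G" "y \<in> carrier G" "x \<otimes> y = y \<otimes> x" for x y
    unfolding q_def that(3) using that by (simp add: m_assoc)
  have q_D: "q z x = \<one>" "q x z = \<one>" if "z \<in> D" "x \<in> carrier G" for z x
    using q_comm[of z x] q_comm[of x z] central[OF that] Dc[OF that(1)] that by auto
  have factor: "\<exists>z\<in>D. x = z \<otimes> y" if "x \<in> carrier G" "y \<in> carrier G" "D #> x = D #> y" for x y
  proof -
    have "x \<in> D #> y" using rcos_self[OF that(1) D.is_subgroup] that(3) by simp
    then show ?thesis by (auto simp: r_coset_def)
  qed
  have q_mod: "q x y = q x' y'"
    if A: "x \<in> carrier G" "x' \<in> carrier G" "D #> x = D #> x'"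
      "y \<in> carrier G" "y' \<in> carrier G" "D #> y = D #> y'" for x x' y y'
  proof -
    obtain z where "z \<in> D" "x = z \<otimes> x'" using factor[OF A(1-3)] by blast
    moreover obtain w where "w \<in> D" "y = w \<otimes> y'" using factor[OF A(4-6)] by blast
    ultimately show ?thesis using A Dc by (simp add: q_left q_right q_D)
  qed
  define S where "S = (\<lambda>(a, b). q a b) ` (insert c F \<times> insert c F)"
  have Sc: "S \<subseteq> D" using c F qD by (auto simp: S_def)
  have gen: "q x y \<in> generate G S" if xy: "x \<in> carrier G" "y \<in> carrier G" for x y
  proof -
    have sub: "subgroup (generate G S) G" using Sc Dc by (intro generate_is_subgroup) auto
    have S: "q a b \<in> generate G S" if "a \<in> insert c F" "b \<in> insert c F" for a b
      using that unfolding S_def by (intro generate.incl) blast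
    note P = subgroup_int_pow_closed[OF sub]
    obtain i j :: int and f g where f: "f \<in> F" "D #> x = D #> (c [^] i \<otimes> f)"
      and g: "g \<in> F" "D #> y = D #> (c [^] j \<otimes> g)"
      using cover[OF xy(1)] cover[OF xy(2)] by blast
    have fg: "f \<in> carrier G" "g \<in> carrier G" using f g F by auto
    have "q x y = q (c [^] i \<otimes> f) (c [^] j \<otimes> g)" using f g fg c xy by (intro q_mod) auto
    also have "\<dots> = q c (c [^] j \<otimes> g) [^] i \<otimes> q f (c [^] j \<otimes> g)"
      using fg c by (simp add: q_left q_pow_left)
    also have "\<dots> = (q c c [^] j \<otimes> q c g) [^] i \<otimes> (q f c [^] j \<otimes> q f g)"
      using fg c by (simp add: q_right q_pow_right)
    also have "\<dots> \<in> generate G S"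
      using f g by (intro generate.eng P S) auto
    finally show ?thesis .
  qed
  have "D \<subseteq> generate G S"
    unfolding D_def derived_def
    using gen Sc Dc by (intro generate_subgroup_incl generate_is_subgroup) (auto simp: q_def)
  moreover have "finite (generate G S)"
  proof -
    let ?D = "G\<lparr>carrier := D\<rparr>"
    interpret DG: comm_group ?D
      using central Dc by (intro group.group_comm_groupI subgroup_imp_group[OF D.is_subgroup]) auto
    have tors: "\<exists>e::int. e > 0 \<and> q x y [^] e = \<one>" if xy: "x \<in> carrier G" "y \<in> carrier G" for x y
    proof -
      have pow: "\<exists>(e::int) (i::int). e > 0 \<and> D #> (u [^] e) = D #> (c [^] i)" if u: "u \<in> carrier G" for u
      proof -
        have sub: "subgroup (carrier (G Mod D)) (G Mod D)" by (rule \<pi>.H.subgroup_self)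
        have "carrier (G Mod D) \<subseteq> {(D #> c) [^]\<^bsub>G Mod D\<^esub> (i::int) \<otimes>\<^bsub>G Mod D\<^esub> f | i f. f \<in> (\<lambda>x. D #> x) ` F}"
        proof
          fix v assume "v \<in> carrier (G Mod D)"
          then obtain g where g: "g \<in> carrier G" "v = D #> g" by (auto simp: carrier_FactGroup)
          obtain i :: int and f where f: "f \<in> F" "v = D #> (c [^] i \<otimes> f)" using cover[OF g(1)] g(2) by auto
          then have "v = (D #> (c [^] i)) \<otimes>\<^bsub>G Mod D\<^esub> (D #> f)"
            using \<pi>.hom_mult[of "c [^] i" f] c F by auto
          also have "D #> (c [^] i) = (D #> c) [^]\<^bsub>G Mod D\<^esub> i" using c by (rule \<pi>.hom_int_pow)
          finally have "v = (D #> c) [^]\<^bsub>G Mod D\<^esub> i \<otimes>\<^bsub>G Mod D\<^esub> (D #> f)" .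
          then show "v \<in> {(D #> c) [^]\<^bsub>G Mod D\<^esub> (i::int) \<otimes>\<^bsub>G Mod D\<^esub> f | i f. f \<in> (\<lambda>x. D #> x) ` F}"
            using f by blast
        qed
        moreover have "finite ((\<lambda>x. D #> x) ` F)" "(\<lambda>x. D #> x) ` F \<subseteq> carrier (G Mod D)"
          using F \<pi>.hom_closed by auto
        ultimately obtain e i :: int where e: "e > 0" "(D #> u) [^]\<^bsub>G Mod D\<^esub> e = (D #> c) [^]\<^bsub>G Mod D\<^esub> i"
          using \<pi>.H.VC_power_in_cyclic[OF \<pi>.hom_closed[OF c] _ _ sub _ \<pi>.hom_closed[OF u]] by blast
        then have "D #> (u [^] e) = D #> (c [^] i)"
          using \<pi>.hom_int_pow[of u e] \<pi>.hom_int_pow[of c i] c u by simp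
        then show ?thesis using e by blast
      qed
      obtain e i :: int where e: "e > 0" "D #> (x [^] e) = D #> (c [^] i)" using pow[OF xy(1)] by blast
      obtain e' j :: int where e': "e' > 0" "D #> (y [^] e') = D #> (c [^] j)" using pow[OF xy(2)] by blast
      have "q x y [^] (e * e') = q (x [^] e) (y [^] e')"
        using xy by (simp add: q_pow_left q_pow_right int_pow_pow mult.commute)
      also have "\<dots> = q (c [^] i) (c [^] j)" using xy c e e' by (intro q_mod) auto
      also have "\<dots> = \<one>"
        using c by (intro q_comm) (auto simp: int_pow_mult[symmetric] add.commute)
      finally show ?thesis using e e' by (intro exI[of _ "e * e'"]) auto
    qed
    have "finite (generate ?D S)"
    proof (rule DG.finite_generate_torsion)
      show "finite S" using F by (simp add: S_def)
      show "S \<subseteq> carrier ?D" using Sc by simp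
      fix s assume s: "s \<in> S"
      then obtain a b where "a \<in> carrier G" "b \<in> carrier G" "s = q a b" using c F by (auto simp: S_def)
      then obtain e :: int where "e > 0" "s [^] e = \<one>" using tors by blast
      moreover have "s [^]\<^bsub>?D\<^esub> e = s [^] e"
        using int_pow_consistent[OF D.is_subgroup, of s e] s Sc by auto
      ultimately show "\<exists>e::int. e > 0 \<and> s [^]\<^bsub>?D\<^esub> e = \<one>\<^bsub>?D\<^esub>" by auto
    qed
    then show ?thesis using generate_consistent[OF Sc D.is_subgroup] by simp
  qed
  ultimately show ?thesis by (rule finite_subset)
qed

lemma (in group) derived_central_of_class_2:
  assumes "nilpotent_of_class 2 G" "z \<in> derived G (carrier G)" "x \<in> carrier G"
  shows "z \<otimes> x = x \<otimes> z"
proof -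
  have der: "derived G (carrier G) = lower_central G 1"
    unfolding derived_def by (auto intro!: arg_cong[of _ _ "generate G"])
  have zc: "z \<in> carrier G" using assms(2) derived_in_carrier by blast
  have "z \<otimes> x \<otimes> inv z \<otimes> inv x \<in> lower_central G (Suc 1)"
    using assms(2,3) unfolding der by (auto intro!: generate.incl)
  also have "lower_central G (Suc 1) = {\<one>}"
    using assms(1) by (simp only: nilpotent_of_class_def numeral_2_eq_2 One_nat_def)
  finally have "z \<otimes> x \<otimes> inv z \<otimes> inv x = \<one>" by simp
  then have "z \<otimes> x \<otimes> inv (x \<otimes> z) = \<one>" using zc assms(3) by (simp add: inv_mult_group m_assoc)
  then show ?thesis using zc assms(3) by (metis inv_closed inv_equality inv_inv m_closed)
qed

section \<open>Coverings of nilpotent-by-abelian groups\<close>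

lemma (in group) VC_of_subgroup:
  assumes N: "subgroup N G" and K: "K \<in> VC G" "K \<subseteq> N"
  shows "K \<in> VC (G\<lparr>carrier := N\<rparr>)"
  using K subgroup_incl[OF _ N] by (simp add: VC_def)

lemma (in group) virtually_cyclic_I:
  assumes "c \<in> carrier G" "finite F" "F \<subseteq> carrier G" "carrier G \<subseteq> {c [^] (i::int) \<otimes> f | i f. f \<in> F}"
  shows "virtually_cyclic G"
proof -
  have "carrier G \<in> VC G" using assms by (intro VC_I[OF subgroup_self])
  then show ?thesis by (simp add: VC_def)
qed

text \<open>Here \<open>M\<close> is the derived group of \<open>N\<close> and \<open>t\<close> generates \<open>G/N\<close> up to the finite set \<open>R\<close> of
  representatives. Conjugators are written as \<open>r t\<^sup>j m\<close>, and the part \<open>r\<close> is absorbed into the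
  finite family of subgroups; this gives \<open>\<K>'\<close>. If \<open>G/N\<close> is finite, then \<open>t\<^sup>j\<close> is absorbed in the
  same way and \<open>N\<close> is covered by its own conjugates of members of \<open>\<K>''\<close>.\<close>

theorem (in group) virtually_cyclic_if_finite_VC_cover:
  assumes N: "N \<lhd> G" and nil: "nilpotent_of_class 2 (G\<lparr>carrier := N\<rparr>)"
    and ab: "comm_group (G Mod N)"
    and fin: "finite \<K>" and VC: "\<K> \<subseteq> VC G"
    and cover: "\<And>g. g \<in> carrier G \<Longrightarrow> \<exists>a\<in>carrier G. \<exists>K\<in>\<K>. a \<otimes> g \<otimes> inv a \<in> K"
  shows "virtually_cyclic G"
proof -
  interpret N: normal N G by (rule N)
  have Nc: "x \<in> carrier G" if "x \<in> N" for x using that by (rule N.mem_carrier)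
  interpret q: group_hom G "G Mod N" "\<lambda>x. N #> x" by (rule N.r_coset_group_hom)
  let ?N = "G\<lparr>carrier := N\<rparr>"
  interpret NG: group ?N by (rule subgroup_imp_group[OF N.is_subgroup])
  define M where "M = derived ?N N"
  have Ndef: "derived ?N (carrier ?N) = M" by (simp add: M_def)
  have MN: "M \<lhd> ?N" using NG.derived_self_is_normal by (simp add: M_def)
  interpret M: normal M ?N by (rule MN)
  let ?A = "?N Mod M"
  have A: "comm_group ?A" using NG.derived_quot_is_comm_group by (simp add: M_def)
  have central: "z \<otimes> x = x \<otimes> z" if "z \<in> M" "x \<in> N" for z x
    using NG.derived_central_of_class_2[OF nil] that by (simp add: M_def)
  have M_sub: "M \<subseteq> N" using M.subset by simp
  have MG: "M \<lhd> G"
    using derived_is_normal[OF N] derived_consistent[OF subset_refl N.is_subgroup] by (simp add: M_def)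
  interpret p: group_hom ?N ?A "\<lambda>x. M #> x"
    using M.r_coset_group_hom by simp
  have conjN: "r \<otimes> x \<otimes> inv r \<in> N" if "r \<in> carrier G" "x \<in> N" for r x
    using N.inv_op_closed2[OF that] .
  obtain t R where t: "t \<in> carrier G" and R: "finite R" "R \<subseteq> carrier G"
    and tR: "\<And>g. g \<in> carrier G \<Longrightarrow> \<exists>(i::int). \<exists>r\<in>R. N #> g = N #> (t [^] i \<otimes> r)"
    by (rule q.abelian_image_cyclic_cover[OF ab fin VC cover]) (assumption | rule that)+
  have tc [simp]: "t [^] (j::int) \<in> carrier G" for j using t by simp
  have decomp: "\<exists>(j::int). \<exists>r\<in>R. \<exists>x\<in>N. g = x \<otimes> (t [^] j \<otimes> r)" if g: "g \<in> carrier G" for g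
  proof -
    obtain j :: int and r where r: "r \<in> R" "N #> g = N #> (t [^] j \<otimes> r)" using tR[OF g] by blast
    have "g \<in> N #> (t [^] j \<otimes> r)" using rcos_self[OF g N.is_subgroup] r(2) by simp
    then show ?thesis using r(1) by (auto simp: r_coset_def)
  qed
  define \<K>' where "\<K>' = (\<lambda>(K, r). (\<lambda>x. inv r \<otimes> x \<otimes> inv (inv r)) ` K) ` (\<K> \<times> R)"
  have fin': "finite \<K>'" using fin R by (simp add: \<K>'_def)
  have VC': "\<K>' \<subseteq> VC G" using VC R by (auto simp: \<K>'_def intro!: VC_conjugate)
  have cover': "\<exists>j::int. \<exists>m\<in>N. \<exists>K\<in>\<K>'. (t [^] j \<otimes> m) \<otimes> g \<otimes> inv (t [^] j \<otimes> m) \<in> K"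
    if g: "g \<in> carrier G" for g
  proof -
    obtain a K where a: "a \<in> carrier G" "K \<in> \<K>" "a \<otimes> g \<otimes> inv a \<in> K" using cover[OF g] by blast
    obtain j :: int and r where r: "r \<in> R" "N #> a = N #> (t [^] j \<otimes> r)" using tR[OF a(1)] by blast
    have rc: "r \<in> carrier G" using r R by blast
    interpret Q: comm_group "G Mod N" by (rule ab)
    have "N #> (t [^] j \<otimes> r) = N #> (r \<otimes> t [^] j)"
      using rc q.hom_mult[of r "t [^] j"] q.hom_mult[of "t [^] j" r]
        Q.m_comm[OF q.hom_closed[OF rc] q.hom_closed[OF tc]] by simp
    then have "a \<in> N #> (r \<otimes> t [^] j)" using r rcos_self[OF a(1) N.is_subgroup] by simp
    also have "\<dots> = (r \<otimes> t [^] j) <# N" using N.coset_eq rc by simp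
    finally obtain m where m: "m \<in> N" "a = (r \<otimes> t [^] j) \<otimes> m" by (auto simp: l_coset_def)
    let ?s = "t [^] j \<otimes> m"
    have s: "?s \<in> carrier G" using Nc[OF m(1)] by simp
    have "a = r \<otimes> ?s" using m Nc[OF m(1)] rc by (simp add: m_assoc)
    then have "?s = inv r \<otimes> a" using rc s by (simp add: m_assoc[symmetric])
    then have eq: "?s \<otimes> g \<otimes> inv ?s = inv r \<otimes> (a \<otimes> g \<otimes> inv a) \<otimes> inv (inv r)"
      using rc a g by (simp add: m_assoc inv_mult_group)
    show ?thesis
    proof (intro exI[of _ j] bexI[of _ m] bexI[of _ "(\<lambda>x. inv r \<otimes> x \<otimes> inv (inv r)) ` K"])
      show "?s \<otimes> g \<otimes> inv ?s \<in> (\<lambda>x. inv r \<otimes> x \<otimes> inv (inv r)) ` K"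
        unfolding eq using a(3) by (rule imageI)
      show "(\<lambda>x. inv r \<otimes> x \<otimes> inv (inv r)) ` K \<in> \<K>'"
        using a(2) r(1) by (auto simp: \<K>'_def)
    qed (rule m(1))
  qed
  have cover_N: "finite M \<and> (\<exists>F'. finite F' \<and> F' \<subseteq> N \<and> N \<subseteq> {c [^] (i::int) \<otimes> f | i f. f \<in> F'})"
    if c: "c \<in> N" and F: "finite F" "F \<subseteq> N"
      and cF: "\<And>x. x \<in> N \<Longrightarrow> \<exists>(i::int). \<exists>f\<in>F. M #> x = M #> (c [^] i \<otimes> f)" for c F
  proof
    have pw: "c [^]\<^bsub>?N\<^esub> i = c [^] i" for i :: int using int_pow_consistent[OF N.is_subgroup c] by simp
    show M_fin: "finite M"
    proof (rule NG.finite_derived_of_central[of c F, unfolded Ndef])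
      show "z \<otimes>\<^bsub>?N\<^esub> x = x \<otimes>\<^bsub>?N\<^esub> z" if "z \<in> M" "x \<in> carrier ?N" for z x
        using central that by simp
      show "\<exists>(i::int). \<exists>f\<in>F. M #>\<^bsub>?N\<^esub> x = M #>\<^bsub>?N\<^esub> (c [^]\<^bsub>?N\<^esub> i \<otimes>\<^bsub>?N\<^esub> f)"
        if "x \<in> carrier ?N" for x
        using cF that by (simp add: pw)
    qed (use c F in auto)
    show "\<exists>F'. finite F' \<and> F' \<subseteq> N \<and> N \<subseteq> {c [^] (i::int) \<otimes> f | i f. f \<in> F'}"
    proof (intro exI[of _ "(\<lambda>(z, f). z \<otimes> f) ` (M \<times> F)"] conjI)
      show "finite ((\<lambda>(z, f). z \<otimes> f) ` (M \<times> F))" using M_fin F by simp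
      show "(\<lambda>(z, f). z \<otimes> f) ` (M \<times> F) \<subseteq> N" using M_sub F by (auto intro!: N.m_closed)
      show "N \<subseteq> {c [^] (i::int) \<otimes> f | i f. f \<in> (\<lambda>(z, f). z \<otimes> f) ` (M \<times> F)}"
      proof
        fix x assume x: "x \<in> N"
        obtain i :: int and f where f: "f \<in> F" "M #> x = M #> (c [^] i \<otimes> f)" using cF[OF x] by blast
        have "x \<in> M #> (c [^] i \<otimes> f)"
          using rcos_self[OF Nc[OF x] normal_imp_subgroup[OF MG]] f(2) by simp
        then obtain z where z: "z \<in> M" "x = z \<otimes> (c [^] i \<otimes> f)" by (auto simp: r_coset_def)
        have car: "z \<in> carrier G" "c \<in> carrier G" "f \<in> carrier G" using z f c F M_sub Nc by auto
        have "z \<otimes> c [^] i = c [^] i \<otimes> z"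
          using central[OF z(1)] subgroup_int_pow_closed[OF N.is_subgroup c] by simp
        then have "x = c [^] i \<otimes> (z \<otimes> f)" using z car by (simp add: m_assoc[symmetric])
        then show "x \<in> {c [^] (i::int) \<otimes> f | i f. f \<in> (\<lambda>(z, f). z \<otimes> f) ` (M \<times> F)}"
          using z(1) f(1) by blast
      qed
    qed
  qed
  \<comment> \<open>The quotient \<open>G/N\<close> is finite in the first case and infinite in the second. The infinite cyclic
    part of \<open>G\<close>, if any, then comes from \<open>c \<in> N\<close> and from \<open>t\<close>, respectively.\<close>
  show ?thesis
  proof (cases "\<exists>k::int. k > 0 \<and> t [^] k \<in> N")
    case True
    then obtain k :: int where k: "k > 0" "t [^] k \<in> N" by blast
    have red: "\<exists>y\<in>N. t [^] (j::int) = t [^] (j mod k) \<otimes> y \<and> t [^] j = y \<otimes> t [^] (j mod k)" for j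
    proof (intro bexI[of _ "t [^] (k * (j div k))"] conjI)
      show "t [^] (k * (j div k)) \<in> N"
        using subgroup_int_pow_dvd[OF N.is_subgroup t k(2)] by simp
    qed (simp_all add: int_pow_mult[OF t, symmetric])
    define \<K>'' where "\<K>'' = (\<lambda>(K, j). ((\<lambda>x. inv (t [^] (j::int)) \<otimes> x \<otimes> inv (inv (t [^] j))) ` K) \<inter> N) ` (\<K>' \<times> {0..<k})"
    have VC'': "\<K>'' \<subseteq> VC ?N"
    proof
      fix L assume "L \<in> \<K>''"
      then obtain K and j :: int where K: "K \<in> \<K>'"
        "L = ((\<lambda>x. inv (t [^] j) \<otimes> x \<otimes> inv (inv (t [^] j))) ` K) \<inter> N"
        unfolding \<K>''_def by (auto simp del: inv_inv)
      have "L \<in> VC G"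
        unfolding K(2) by (intro VC_Int VC_conjugate N.is_subgroup subsetD[OF VC' K(1)] inv_closed tc)
      then show "L \<in> VC ?N" using K(2) by (intro VC_of_subgroup[OF N.is_subgroup]) auto
    qed
    have cover'': "\<exists>m\<in>carrier ?N. \<exists>K\<in>\<K>''. m \<otimes>\<^bsub>?N\<^esub> x \<otimes>\<^bsub>?N\<^esub> inv\<^bsub>?N\<^esub> m \<in> K" if x: "x \<in> carrier ?N" for x
    proof -
      have xN: "x \<in> N" using x by simp
      obtain j :: int and m K where jm: "m \<in> N" "K \<in> \<K>'" "(t [^] j \<otimes> m) \<otimes> x \<otimes> inv (t [^] j \<otimes> m) \<in> K"
        using cover'[OF Nc[OF xN]] by blast
      obtain y where y: "y \<in> N" "t [^] j = t [^] (j mod k) \<otimes> y" using red by blast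
      let ?s = "t [^] (j mod k)" and ?m = "y \<otimes> m"
      have m: "?m \<in> N" using y jm by simp
      have "t [^] j \<otimes> m = ?s \<otimes> ?m" using y jm Nc by (simp add: m_assoc)
      then have "(t [^] j \<otimes> m) \<otimes> x \<otimes> inv (t [^] j \<otimes> m) = ?s \<otimes> (?m \<otimes> x \<otimes> inv ?m) \<otimes> inv ?s"
        using Nc[OF m] Nc[OF xN] by (simp add: m_assoc inv_mult_group)
      then have in_K: "?s \<otimes> (?m \<otimes> x \<otimes> inv ?m) \<otimes> inv ?s \<in> K" using jm(3) by simp
      have u: "?m \<otimes> x \<otimes> inv ?m \<in> N" using conjN[OF Nc[OF m] xN] .
      have "inv ?s \<otimes> (?s \<otimes> (?m \<otimes> x \<otimes> inv ?m) \<otimes> inv ?s) \<otimes> inv (inv ?s)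
          = (inv ?s \<otimes> ?s) \<otimes> (?m \<otimes> x \<otimes> inv ?m) \<otimes> (inv ?s \<otimes> ?s)"
        using Nc[OF u] tc by (simp only: m_assoc inv_inv m_closed inv_closed)
      also have "\<dots> = ?m \<otimes> x \<otimes> inv ?m" using Nc[OF u] by simp
      finally have eq: "inv ?s \<otimes> (?s \<otimes> (?m \<otimes> x \<otimes> inv ?m) \<otimes> inv ?s) \<otimes> inv (inv ?s) = ?m \<otimes> x \<otimes> inv ?m" .
      have "?m \<otimes> x \<otimes> inv ?m \<in> (\<lambda>x. inv ?s \<otimes> x \<otimes> inv (inv ?s)) ` K"
        using imageI[OF in_K, of "\<lambda>x. inv ?s \<otimes> x \<otimes> inv (inv ?s)"] unfolding eq .
      then have "?m \<otimes> x \<otimes> inv ?m \<in> ((\<lambda>x. inv ?s \<otimes> x \<otimes> inv (inv ?s)) ` K) \<inter> N"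
        using u by (rule IntI)
      moreover have "((\<lambda>x. inv ?s \<otimes> x \<otimes> inv (inv ?s)) ` K) \<inter> N \<in> \<K>''"
        unfolding \<K>''_def using jm(2) k(1) by (intro image_eqI[of _ _ "(K, j mod k)"]) auto
      ultimately have "\<exists>K\<in>\<K>''. ?m \<otimes> x \<otimes> inv ?m \<in> K" by (rule rev_bexI[rotated])
      then show ?thesis using m m_inv_consistent[OF N.is_subgroup m] by (intro bexI[of _ ?m]) simp_all
    qed
    have fin'': "finite \<K>''" using fin' by (simp add: \<K>''_def)
    obtain c F where cF: "c \<in> carrier ?N" "finite F" "F \<subseteq> carrier ?N"
      "\<And>x. x \<in> carrier ?N \<Longrightarrow> \<exists>(i::int). \<exists>f\<in>F. M #> x = M #> (c [^]\<^bsub>?N\<^esub> i \<otimes>\<^bsub>?N\<^esub> f)"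
      by (rule p.abelian_image_cyclic_cover[OF A fin'' VC'' cover'']) (assumption | rule that)+
    have c: "c \<in> N" using cF by simp
    have "\<exists>(i::int). \<exists>f\<in>F. M #> x = M #> (c [^] i \<otimes> f)" if "x \<in> N" for x
      using cF(4)[of x] that int_pow_consistent[OF N.is_subgroup c] by simp
    then obtain F' where F': "finite F'" "F' \<subseteq> N" "N \<subseteq> {c [^] (i::int) \<otimes> f | i f. f \<in> F'}"
      using cover_N[of c F] cF by auto
    define E where "E = (\<lambda>(f, j, r). f \<otimes> (t [^] (j::int) \<otimes> r)) ` (F' \<times> {0..<k} \<times> R)"
    show ?thesis
    proof (rule virtually_cyclic_I)
      show "c \<in> carrier G" using Nc[OF c] .
      show "finite E" using F' R by (simp add: E_def)
      have "F' \<subseteq> carrier G" using F'(2) Nc by blast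
      then show "E \<subseteq> carrier G" using R(2) by (auto simp: E_def subset_iff)
      show "carrier G \<subseteq> {c [^] (i::int) \<otimes> f | i f. f \<in> E}"
      proof
        fix g assume "g \<in> carrier G"
        then obtain j :: int and r x where g: "r \<in> R" "x \<in> N" "g = x \<otimes> (t [^] j \<otimes> r)" using decomp by blast
        obtain y where y: "y \<in> N" "t [^] j = y \<otimes> t [^] (j mod k)" using red by blast
        obtain i :: int and f where f: "f \<in> F'" "x \<otimes> y = c [^] i \<otimes> f"
          using F'(3) N.m_closed[OF g(2) y(1)] by blast
        have car: "r \<in> carrier G" "x \<in> carrier G" "y \<in> carrier G" "f \<in> carrier G" "c \<in> carrier G"
          using g y f F' R Nc c by auto
        have "g = (x \<otimes> y) \<otimes> (t [^] (j mod k) \<otimes> r)" unfolding g(3) y(2) using car by (simp add: m_assoc)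
        also have "\<dots> = c [^] i \<otimes> (f \<otimes> (t [^] (j mod k) \<otimes> r))" unfolding f(2) using car by (simp add: m_assoc)
        finally have "g = c [^] i \<otimes> (f \<otimes> (t [^] (j mod k) \<otimes> r))" .
        moreover have "f \<otimes> (t [^] (j mod k) \<otimes> r) \<in> E"
          unfolding E_def using f g k by (intro image_eqI[of _ _ "(f, j mod k, r)"]) auto
        ultimately show "g \<in> {c [^] (i::int) \<otimes> f | i f. f \<in> E}" by blast
      qed
    qed
  next
    case False
    have free: "t [^] i \<notin> N" if "i \<noteq> 0" for i :: int
    proof
      assume "t [^] i \<in> N"
      then have "t [^] \<bar>i\<bar> \<in> N" by (rule subgroup_int_pow_dvd[OF N.is_subgroup t]) simp
      then show False using False that by (metis zero_less_abs_iff)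
    qed
    define T where "T j U = (\<lambda>u. t [^] (j::int) \<otimes> u \<otimes> inv (t [^] j)) ` U" for j U
    have T: "T j (M #> x) = M #> (t [^] j \<otimes> x \<otimes> inv (t [^] j))" if x: "x \<in> N" for j x
    proof -
      let ?s = "t [^] j"
      have xc: "x \<in> carrier G" using Nc[OF x] .
      have Mc: "z \<in> carrier G" if "z \<in> M" for z using that M_sub Nc by blast
      have conj: "?s \<otimes> (z \<otimes> x) \<otimes> inv ?s = (?s \<otimes> z \<otimes> inv ?s) \<otimes> (?s \<otimes> x \<otimes> inv ?s)" if "z \<in> M" for z
      proof -
        have "(?s \<otimes> z \<otimes> inv ?s) \<otimes> (?s \<otimes> x \<otimes> inv ?s) = ?s \<otimes> z \<otimes> (inv ?s \<otimes> ?s) \<otimes> x \<otimes> inv ?s"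
          using Mc[OF that] xc tc by (simp only: m_assoc m_closed inv_closed)
        then show ?thesis using Mc[OF that] xc by (simp add: m_assoc)
      qed
      show ?thesis
      proof (intro equalityI subsetI)
        fix u assume "u \<in> T j (M #> x)"
        then obtain z where z: "z \<in> M" "u = ?s \<otimes> (z \<otimes> x) \<otimes> inv ?s" by (auto simp: T_def r_coset_def)
        have "?s \<otimes> z \<otimes> inv ?s \<in> M" using normal.inv_op_closed2[OF MG tc z(1)] .
        then show "u \<in> M #> (?s \<otimes> x \<otimes> inv ?s)" unfolding z(2) conj[OF z(1)] by (auto simp: r_coset_def)
      next
        fix u assume "u \<in> M #> (?s \<otimes> x \<otimes> inv ?s)"
        then obtain w where w: "w \<in> M" "u = w \<otimes> (?s \<otimes> x \<otimes> inv ?s)" by (auto simp: r_coset_def)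
        define z where "z = inv ?s \<otimes> w \<otimes> ?s"
        have z: "z \<in> M" unfolding z_def using normal.inv_op_closed1[OF MG tc w(1)] .
        have "?s \<otimes> z \<otimes> inv ?s = (?s \<otimes> inv ?s) \<otimes> w \<otimes> (?s \<otimes> inv ?s)"
          unfolding z_def using Mc[OF w(1)] tc by (simp only: m_assoc m_closed inv_closed)
        then have "?s \<otimes> z \<otimes> inv ?s = w" using Mc[OF w(1)] by simp
        then have "u = ?s \<otimes> (z \<otimes> x) \<otimes> inv ?s" using conj[OF z] w by simp
        then show "u \<in> T j (M #> x)" unfolding T_def r_coset_def using z by blast
      qed
    qed
    have p_hom: "(\<lambda>x. M #> x) \<in> hom ?N ?A" using p.homh .
    have p_surj: "(\<lambda>x. M #> x) ` N = carrier ?A" by (simp add: carrier_FactGroup)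
    have fin_A: "finite (carrier ?A)"
      by (rule finite_abelian_section[OF N t free A p_hom p_surj T fin' VC' cover'])
    define r where "r U = (SOME x. x \<in> N \<and> M #> x = U)" for U
    have r: "r U \<in> N \<and> M #> r U = U" if "U \<in> carrier ?A" for U
    proof -
      have "U \<in> (\<lambda>x. M #> x) ` N" unfolding p_surj using that .
      then have "\<exists>x. x \<in> N \<and> M #> x = U" by auto
      then show ?thesis unfolding r_def by (rule someI_ex)
    qed
    have one_cover: "\<exists>(i::int). \<exists>f\<in>r ` carrier ?A. M #> x = M #> (\<one> [^] i \<otimes> f)" if x: "x \<in> N" for x
    proof -
      have U: "M #> x \<in> carrier ?A" unfolding p_surj[symmetric] using x by (rule imageI)
      have "M #> x = M #> (\<one> [^] (0::int) \<otimes> r (M #> x))" using r[OF U] Nc by simp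
      then show ?thesis using U by blast
    qed
    have rN: "r ` carrier ?A \<subseteq> N" using r by blast
    have "finite M \<and> (\<exists>F'. finite F' \<and> F' \<subseteq> N \<and> N \<subseteq> {\<one> [^] (i::int) \<otimes> f | i f. f \<in> F'})"
      by (rule cover_N[OF N.one_closed finite_imageI[OF fin_A] rN one_cover])
    then obtain F' where F': "finite F'" "F' \<subseteq> N" "N \<subseteq> {\<one> [^] (i::int) \<otimes> f | i f. f \<in> F'}"
      by (elim conjE exE)
    have "N \<subseteq> F'"
    proof
      fix x assume "x \<in> N"
      then obtain i :: int and f where "f \<in> F'" "x = \<one> [^] i \<otimes> f" using F'(3) by blast
      then show "x \<in> F'" using F'(2) Nc by (simp add: subsetD)
    qed
    then have fin_N: "finite N" using F' finite_subset by blast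
    show ?thesis
    proof (rule virtually_cyclic_I[OF t])
      let ?E = "(\<lambda>(x, r). x \<otimes> r) ` (N \<times> R)"
      show "finite ?E" using fin_N R by simp
      show "?E \<subseteq> carrier G" using R Nc by auto
      show "carrier G \<subseteq> {t [^] (i::int) \<otimes> f | i f. f \<in> ?E}"
      proof
        fix g assume "g \<in> carrier G"
        then obtain j :: int and r x where g: "r \<in> R" "x \<in> N" "g = x \<otimes> (t [^] j \<otimes> r)" using decomp by blast
        let ?x = "inv (t [^] j) \<otimes> x \<otimes> t [^] j"
        have x: "?x \<in> N" using N.inv_op_closed1[OF tc g(2)] .
        have car: "x \<in> carrier G" "r \<in> carrier G" using g R Nc by auto
        have "t [^] j \<otimes> (?x \<otimes> r) = (t [^] j \<otimes> inv (t [^] j)) \<otimes> x \<otimes> (t [^] j \<otimes> r)"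
          using car tc by (simp only: m_assoc m_closed inv_closed)
        also have "\<dots> = g" using car g by simp
        finally have "g = t [^] j \<otimes> (?x \<otimes> r)" ..
        then show "g \<in> {t [^] (i::int) \<otimes> f | i f. f \<in> ?E}" using x g(1) by blast
      qed
    qed
  qed
qed

section \<open>The covering given by a Bredon resolution\<close>

definition left_coset_gset :: "('a, 'b) monoid_scheme \<Rightarrow> 'a set \<Rightarrow> ('a, 'a set) gset" where
  "left_coset_gset G H = \<lparr>points = (\<lambda>x. x <#\<^bsub>G\<^esub> H) ` carrier G,
     action = (\<lambda>g. \<lambda>U\<in>(\<lambda>x. x <#\<^bsub>G\<^esub> H) ` carrier G. g <#\<^bsub>G\<^esub> U)\<rparr>"

context group begin

lemma left_coset_gset_action:
  assumes "H \<subseteq> carrier G" "g \<in> carrier G" "x \<in> carrier G"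
  shows "action (left_coset_gset G H) g (x <# H) = (g \<otimes> x) <# H"
  using assms by (simp add: left_coset_gset_def lcos_m_assoc)

lemma left_coset_gset_transitive:
  assumes H: "H \<subseteq> carrier G"
  shows "transitive_action G (points (left_coset_gset G H)) (action (left_coset_gset G H))"
proof -
  let ?E = "points (left_coset_gset G H)" and ?\<phi> = "action (left_coset_gset G H)"
  note act = left_coset_gset_action[OF H]
  have E: "U \<in> ?E \<longleftrightarrow> (\<exists>x\<in>carrier G. U = x <# H)" for U
    by (auto simp: left_coset_gset_def)
  have ext: "?\<phi> g \<in> extensional ?E" for g by (simp add: left_coset_gset_def)
  have inv: "?\<phi> g (?\<phi> (inv g) U) = U" "?\<phi> (inv g) (?\<phi> g U) = U" if "g \<in> carrier G" "U \<in> ?E" for g U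
    using that by (auto simp: E act m_assoc[symmetric])
  have closed: "?\<phi> g U \<in> ?E" if "g \<in> carrier G" "U \<in> ?E" for g U
    using that by (auto simp: E act intro!: bexI)
  have bij: "?\<phi> g \<in> Bij ?E" if g: "g \<in> carrier G" for g
    unfolding Bij_def using ext inv[OF g] closed g
    by (auto intro!: bij_betw_byWitness[where f' = "?\<phi> (inv g)"])
  have "?\<phi> \<in> hom G (BijGroup ?E)"
  proof (rule homI)
    fix g h assume gh: "g \<in> carrier G" "h \<in> carrier G"
    have "?\<phi> (g \<otimes> h) = compose ?E (?\<phi> g) (?\<phi> h)"
    proof (rule extensionalityI[OF ext compose_extensional])
      fix U assume "U \<in> ?E"
      then show "?\<phi> (g \<otimes> h) U = compose ?E (?\<phi> g) (?\<phi> h) U"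
        using gh by (auto simp: compose_def E act m_assoc)
    qed
    then show "?\<phi> (g \<otimes> h) = ?\<phi> g \<otimes>\<^bsub>BijGroup ?E\<^esub> ?\<phi> h"
      using bij gh by (simp add: BijGroup_def)
  qed (use bij in \<open>simp add: BijGroup_def\<close>)
  then have ga: "group_action G ?E ?\<phi>"
    by (simp add: group_action_def group_hom_def group_hom_axioms_def is_group group_BijGroup)
  show ?thesis
  proof (intro transitive_action.intro ga transitive_action_axioms.intro)
    fix U V assume "U \<in> ?E" "V \<in> ?E"
    then obtain x y where xy: "x \<in> carrier G" "U = x <# H" "y \<in> carrier G" "V = y <# H"
      by (auto simp: E)
    then have "?\<phi> (y \<otimes> inv x) U = V" by (simp add: act m_assoc)
    then show "\<exists>g\<in>carrier G. ?\<phi> g U = V" using xy by blast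
  qed
qed

lemma left_coset_gset_object:
  assumes g: "g \<in> carrier G"
  shows "left_coset_gset G (generate G {g}) \<in> orbit_objects G (VC G)"
proof -
  let ?H = "generate G {g}"
  let ?X = "left_coset_gset G ?H"
  have H: "subgroup ?H G" "?H \<subseteq> carrier G"
    using g by (auto simp: generate_is_subgroup generate_incl)
  interpret X: transitive_action G "points ?X" "action ?X"
    by (rule left_coset_gset_transitive[OF H(2)])
  have stab: "stabilizer G (action ?X) U \<in> VC G" if U: "U \<in> points ?X" for U
  proof -
    obtain x where x: "x \<in> carrier G" "U = x <# ?H"
      using U by (auto simp: left_coset_gset_def)
    have "?H \<in> VC G"
      using H generate.incl[of g "{g}" G] subgroup.one_closed[OF H(1)]
      by (intro VC_I[of ?H g "{\<one>}"]) (use g in \<open>auto simp: generate_pow\<close>)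
    then have "(\<lambda>h. x \<otimes> h \<otimes> inv x) ` ?H \<in> VC G" using x by (intro VC_conjugate)
    moreover have "stabilizer G (action ?X) U = (\<lambda>h. x \<otimes> h \<otimes> inv x) ` ?H"
    proof (intro equalityI subsetI)
      fix a assume "a \<in> stabilizer G (action ?X) U"
      then have a: "a \<in> carrier G" "(a \<otimes> x) <# ?H = x <# ?H"
        using x left_coset_gset_action[OF H(2)] by (auto simp: stabilizer_def)
      have "a \<otimes> x \<in> (a \<otimes> x) <# ?H"
        using a x subgroup.one_closed[OF H(1)] by (force simp: l_coset_def)
      then obtain h where h: "h \<in> ?H" "a \<otimes> x = x \<otimes> h" using a(2) by (auto simp: l_coset_def)
      then have "a = x \<otimes> h \<otimes> inv x" using a x H by (metis inv_solve_right m_closed subsetD)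
      then show "a \<in> (\<lambda>h. x \<otimes> h \<otimes> inv x) ` ?H" using h by blast
    next
      fix a assume "a \<in> (\<lambda>h. x \<otimes> h \<otimes> inv x) ` ?H"
      then obtain h where h: "h \<in> ?H" "a = x \<otimes> h \<otimes> inv x" by blast
      have hc: "h \<in> carrier G" using h H by blast
      have "action ?X a U = (x \<otimes> h \<otimes> inv x \<otimes> x) <# ?H"
        using x h hc left_coset_gset_action[OF H(2)] by simp
      also have "\<dots> = x <# (h <# ?H)" using x hc H by (simp add: m_assoc lcos_m_assoc)
      also have "h <# ?H = ?H"
        using coset_join3[OF hc H(1) h(1)] .
      finally show "a \<in> stabilizer G (action ?X) U"
        using x h hc by (simp add: stabilizer_def)
    qed
    ultimately show ?thesis by simp
  qed
  show ?thesis
    unfolding orbit_objects_def gset_with_stabilizers_def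
    using stab X.group_action_axioms X.transitive_action_axioms one_closed
    by (auto simp: left_coset_gset_def)
qed

text \<open>The family \<open>\<K>\<close> consists of the stabilizers of representatives of the orbits of \<open>\<Omega>\<close>, where the
  degree 0 term of the resolution is a direct summand of \<open>\<int>[-, \<Omega>]\<close>. Since its value at \<open>G/\<langle>g\<rangle>\<close>
  maps onto \<open>\<int>\<close>, the free abelian group on the \<open>G\<close>-maps \<open>G/\<langle>g\<rangle> \<rightarrow> \<Omega>\<close> is nontrivial. A
  \<open>G\<close>-map sends the base point to a point fixed by \<open>g\<close>.\<close>

lemma bredon_FP_finite_VC_cover:
  assumes "bredon_FP n G (VC G)"
  obtains \<K> where "finite \<K>" "\<K> \<subseteq> VC G"
    "\<And>g. g \<in> carrier G \<Longrightarrow> \<exists>h\<in>carrier G. \<exists>K\<in>\<K>. h \<otimes> g \<otimes> inv h \<in> K"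
proof -
  obtain P :: "nat \<Rightarrow> ('a, 'a set, ('a set \<Rightarrow> nat \<times> 'a set) \<Rightarrow>\<^sub>0 int) orbit_module"
    and d \<epsilon> where res: "orbit_module_projective_resolution G (VC G) P d \<epsilon> const_int_module"
    and fg: "orbit_module_fg_projective G (VC G) (P 0)"
    using assms unfolding bredon_FP_def by blast
  obtain \<Omega> :: "('a, nat \<times> 'a set) gset"
    and Q :: "('a, 'a set, ('a set \<Rightarrow> nat \<times> 'a set) \<Rightarrow>\<^sub>0 int) orbit_module" where
    \<Omega>: "gset_with_stabilizers G (VC G) \<Omega>" "finite (orbits G (points \<Omega>) (action \<Omega>))"
    and Q: "is_orbit_module G (VC G) Q"
    and iso: "orbit_module_iso G (VC G) (orbit_module_sum (P 0) Q) (free_orbit_module G \<Omega>)"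
    using fg unfolding orbit_module_fg_projective_def by blast
  have PM: "is_orbit_module G (VC G) (P 0)"
    using fg unfolding orbit_module_fg_projective_def orbit_module_projective_def by blast
  interpret \<Omega>: group_action G "points \<Omega>" "action \<Omega>"
    using \<Omega>(1) by (simp add: gset_with_stabilizers_def)
  define st where "st Z = stabilizer G (action \<Omega>) (SOME w. w \<in> Z)" for Z
  define \<K> where "\<K> = st ` orbits G (points \<Omega>) (action \<Omega>)"
  have rep: "(SOME w. w \<in> Z) \<in> Z \<and> (SOME w. w \<in> Z) \<in> points \<Omega>"
    if Z: "Z \<in> orbits G (points \<Omega>) (action \<Omega>)" for Z
  proof -
    obtain x where x: "x \<in> points \<Omega>" "Z = orbit G (action \<Omega>) x"
      using Z unfolding orbits_def by blast
    then have "x \<in> Z" using \<Omega>.orbit_refl by simp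
    then have "(SOME w. w \<in> Z) \<in> Z" by (rule someI)
    moreover have "u \<in> points \<Omega>" if "u \<in> Z" for u
      using that x \<Omega>.element_image unfolding orbit_def by blast
    ultimately show ?thesis by blast
  qed
  have "finite \<K>" using \<Omega>(2) by (simp add: \<K>_def)
  moreover have "\<K> \<subseteq> VC G"
    using rep \<Omega>(1) by (auto simp: \<K>_def st_def gset_with_stabilizers_def)
  moreover have "\<exists>h\<in>carrier G. \<exists>K\<in>\<K>. h \<otimes> g \<otimes> inv h \<in> K" if g: "g \<in> carrier G" for g
  proof -
    let ?H = "generate G {g}"
    define X where "X = left_coset_gset G ?H"
    have X: "X \<in> orbit_objects G (VC G)" unfolding X_def by (rule left_coset_gset_object[OF g])
    have H: "subgroup ?H G" "?H \<subseteq> carrier G"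
      using g by (auto simp: generate_is_subgroup generate_incl)
    interpret PX: comm_group "ev (P 0) X" using PM X by (simp add: is_orbit_module_def)
    interpret QX: comm_group "ev Q X" using Q X by (simp add: is_orbit_module_def)
    have \<epsilon>: "\<epsilon> X \<in> hom (ev (P 0) X) integer_group" "\<epsilon> X ` carrier (ev (P 0) X) = UNIV"
      using res X by (auto simp: orbit_module_projective_resolution_def orbit_module_hom_def const_int_module_def)
    obtain p where p: "p \<in> carrier (ev (P 0) X)" "\<epsilon> X p = 1"
      using \<epsilon>(2) by (metis UNIV_I imageE)
    have "\<epsilon> X \<one>\<^bsub>ev (P 0) X\<^esub> = 0"
      using hom_one[OF \<epsilon>(1) PX.is_group] by simp
    then have p1: "p \<noteq> \<one>\<^bsub>ev (P 0) X\<^esub>" using p by auto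
    obtain \<eta> where "\<eta> \<in> Group.iso (ev (P 0) X \<times>\<times> ev Q X) (free_Abelian_group (gset_maps G X \<Omega>))"
      using iso X by (auto simp: orbit_module_iso_def orbit_module_sum_def free_orbit_module_def)
    then have \<eta>: "bij_betw \<eta> (carrier (ev (P 0) X) \<times> carrier (ev Q X))
        {c. Poly_Mapping.keys c \<subseteq> gset_maps G X \<Omega>}"
      by (simp add: Group.iso_def free_Abelian_group_def)
    have "gset_maps G X \<Omega> \<noteq> {}"
    proof
      assume e: "gset_maps G X \<Omega> = {}"
      have "\<eta> (p, \<one>\<^bsub>ev Q X\<^esub>) = 0" "\<eta> (\<one>\<^bsub>ev (P 0) X\<^esub>, \<one>\<^bsub>ev Q X\<^esub>) = 0"
        using bij_betwE[OF \<eta>] p(1) by (auto simp: e)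
      then have "(p, \<one>\<^bsub>ev Q X\<^esub>) = (\<one>\<^bsub>ev (P 0) X\<^esub>, \<one>\<^bsub>ev Q X\<^esub>)"
        using p(1) by (intro inj_onD[OF bij_betw_imp_inj_on[OF \<eta>]]) auto
      then show False using p1 by simp
    qed
    then obtain f where f: "f \<in> points X \<rightarrow>\<^sub>E points \<Omega>"
      "\<And>a x. a \<in> carrier G \<Longrightarrow> x \<in> points X \<Longrightarrow> f (action X a x) = action \<Omega> a (f x)"
      by (auto simp: gset_maps_def)
    have base: "?H \<in> points X"
      unfolding X_def left_coset_gset_def using lcos_mult_one[OF H(2)] by force
    have "action X g (\<one> <# ?H) = (g \<otimes> \<one>) <# ?H"
      unfolding X_def using g by (intro left_coset_gset_action[OF H(2)]) auto
    also have "\<dots> = ?H" using coset_join3[OF g H(1)] g by (simp add: generate.incl)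
    finally have "action X g ?H = ?H" using lcos_mult_one[OF H(2)] by simp
    define w where "w = f ?H"
    have w: "w \<in> points \<Omega>" "action \<Omega> g w = w"
      using f(1) base f(2)[OF g base] \<open>action X g ?H = ?H\<close> by (auto simp: w_def)
    define Z where "Z = orbit G (action \<Omega>) w"
    have Z: "Z \<in> orbits G (points \<Omega>) (action \<Omega>)" using w(1) unfolding Z_def orbits_def by blast
    define v where "v = (SOME v. v \<in> Z)"
    have v: "v \<in> Z" "v \<in> points \<Omega>" using rep[OF Z] by (auto simp: v_def)
    then obtain h where h: "h \<in> carrier G" "action \<Omega> h w = v" by (auto simp: Z_def orbit_def)
    have hv: "action \<Omega> (inv h) v = w" using \<Omega>.orbit_sym_aux[OF h(1) w(1) h(2)] .
    have "action \<Omega> (h \<otimes> g \<otimes> inv h) v = action \<Omega> (h \<otimes> g) (action \<Omega> (inv h) v)"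
      using h g v by (intro \<Omega>.composition_rule) auto
    also have "\<dots> = action \<Omega> h (action \<Omega> g w)" unfolding hv using h g w by (intro \<Omega>.composition_rule) auto
    also have "\<dots> = v" using w h by simp
    finally have "h \<otimes> g \<otimes> inv h \<in> st Z"
      using h g by (simp add: st_def stabilizer_def v_def)
    then show ?thesis using h Z by (auto simp: \<K>_def)
  qed
  ultimately show thesis by (rule that)
qed

end

theorem theorem5p3:
  fixes G :: "('a, 'b) monoid_scheme"
  assumes "group G"
    and "nilpotent_by_abelian 2 G"
    and "bredon_FP 2 G (VC G)"
    and "\<And>g. \<lbrakk>g \<in> carrier G; group.ord G g = 0\<rbrakk> \<Longrightarrow>
           group_FP 2 (G\<lparr>carrier := centralizer G g\<rparr>)"
  shows "virtually_cyclic G"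
proof -
  interpret group G by (rule assms(1))
  obtain N where N: "N \<lhd> G" "nilpotent_of_class 2 (G\<lparr>carrier := N\<rparr>)" "comm_group (G Mod N)"
    using assms(2) unfolding nilpotent_by_abelian_def by blast
  obtain \<K> where \<K>: "finite \<K>" "\<K> \<subseteq> VC G"
    "\<And>g. g \<in> carrier G \<Longrightarrow> \<exists>h\<in>carrier G. \<exists>K\<in>\<K>. h \<otimes>\<^bsub>G\<^esub> g \<otimes>\<^bsub>G\<^esub> inv\<^bsub>G\<^esub> h \<in> K"
    by (rule bredon_FP_finite_VC_cover[OF assms(3)]) (assumption | rule that)+
  show ?thesis by (rule virtually_cyclic_if_finite_VC_cover[OF N \<K>])
qed

end
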